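(* Let $d \geq 2$, let $\mathrm{Sym}_d$ be the additive group of symmetric $d\times d$ integer matrices, and let $E \subset \mathrm{Sym}_d$ be a set of positive upper Banach density. Let $m$ be a positive integer. Then there exists a positive integer $k$ such that for every finite subset $F \subset \mathrm{Sym}_d$ with $|F| = m$ there is some $b \in E$ with $$k^d \, \det(F) \subset \det(E-b).$$ If $E$ is an aperiodic Bohr set, then $k$ can be chosen to be $1$. In particular, if $E$ is an aperiodic Bohr$_o$-set, then $\det(E) = \mathbb{Z}$.
   Context: $\mathrm{Sym}_d$ is identified with $\mathbb{Z}^N$, $N = d(d+1)/2$, by a choice of $\mathbb{Z}$-basis, and the following notions for subsets of $\mathbb{Z}^N$ are transported to $\mathrm{Sym}_d$. Upper Banach density: for $E \subset \mathbb{Z}^N$ and $F_n = [-n,n]^N \cap \mathbb{Z}^N$, $d^*(E) = \sup\{ \limsup_n |E \cap (F_n + a_n)|/|F_n| : (a_n) \text{ a sequence in } \mathbb{Z}^N\}$. $E$ has positive upper Banach density if $d^*(E)>0$. Bohr sets: $E \subset \mathbb{Z}^N$ is a Bohr set if there exist a compact second countable abelian group $K$ with Haar probability measure $m_K$, a homomorphism $\tau : \mathbb{Z}^N \to K$ with dense image, and a non-empty open set $U \subset K$ with $m_K(\overline{U}) = m_K(U)$ such that $E = \tau^{-1}(U)$. If moreover such $K$ can be taken connected, $E$ is an aperiodic Bohr set; if such $K$ can be taken connected with $U$ containing the identity element of $K$, $E$ is an aperiodic Bohr$_o$-set. Notation: $E-b = \{e-b : e\in E\}$, $\det(S) = \{\det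 s: s \in S\}$, $k^d\det(F) = \{k^d \det f : f \in F\}$. *)

theory Defs
  imports "HOL-Probability.Probability_Measure"
begin

definition Sym :: "(int^'n^'n) set" where
  "Sym = {A. transpose A = A}"

text \<open>A family \<open>B\<close> is a \<open>\<int>\<close>-basis of \<open>Sym\<close> iff taking integer combinations of it is a
  bijection from \<open>\<int>\<^sup>N\<close> onto \<open>Sym\<close>.  The sum is written entrywise because \<open>c *s A\<close> would
  require \<open>c\<close> to be a vector here.\<close>

definition from_coords :: "('N::finite \<Rightarrow> int^'n^'n) \<Rightarrow> int^'N \<Rightarrow> int^'n^'n" where
  "from_coords B x = (\<chi> r s. \<Sum>i\<in>UNIV. x $ i * B i $ r $ s)"

definition Z_basis_of_Sym :: "('N::finite \<Rightarrow> int^'n^'n) \<Rightarrow> bool" where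
  "Z_basis_of_Sym B \<longleftrightarrow> bij_betw (from_coords B) UNIV Sym"

definition Folner_box :: "nat \<Rightarrow> (int^'N) set" where
  "Folner_box n = {x. \<forall>i. \<bar>x $ i\<bar> \<le> int n}"

definition upper_Banach_density :: "(int^'N::finite) set \<Rightarrow> ereal" where
  "upper_Banach_density E =
     (SUP a :: nat \<Rightarrow> int^'N.
        limsup (\<lambda>n. ereal (real (card (E \<inter> (\<lambda>x. x + a n) ` Folner_box n))
                         / real (card (Folner_box n :: (int^'N) set)))))"

text \<open>On a second countable compact group every finite Borel measure is regular, so
  translation invariance characterises the Haar probability measure.\<close>

definition Haar_prob :: "'k::topological_ab_group_add measure \<Rightarrow> bool" where
  "Haar_prob M \<longleftrightarrow> prob_space M \<and> sets M = sets borel \<and> (\<forall>a. distr M borel (\<lambda>x. a + x) = M)"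

text \<open>The group \<open>K\<close> is the type \<open>'k\<close>.  A definition cannot quantify existentially over types,
  so \<open>'k\<close> is an explicit parameter of the notions below; a theorem that assumes them for a
  type variable \<open>'k\<close> holds for every \<open>K\<close>.\<close>

definition Bohr_data ::
  "(int^'N::finite \<Rightarrow> 'k::{topological_ab_group_add, second_countable_topology, t2_space})
     \<Rightarrow> 'k set \<Rightarrow> (int^'N) set \<Rightarrow> bool" where
  "Bohr_data \<tau> U E \<longleftrightarrow>
     compact (UNIV :: 'k set) \<and>
     (\<forall>x y. \<tau> (x + y) = \<tau> x + \<tau> y) \<and> closure (range \<tau>) = UNIV \<and>
     U \<noteq> {} \<and> open U \<and> (\<exists>M. Haar_prob M \<and> emeasure M (closure U) = emeasure M U) \<and>
     E = \<tau> -` U"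

definition aperiodic_Bohr_set ::
  "'k::{topological_ab_group_add, second_countable_topology, t2_space} itself
     \<Rightarrow> (int^'N::finite) set \<Rightarrow> bool" where
  "aperiodic_Bohr_set _ E \<longleftrightarrow>
     (\<exists>(\<tau> :: int^'N \<Rightarrow> 'k) U. Bohr_data \<tau> U E \<and> connected (UNIV :: 'k set))"

definition aperiodic_Bohr0_set ::
  "'k::{topological_ab_group_add, second_countable_topology, t2_space} itself
     \<Rightarrow> (int^'N::finite) set \<Rightarrow> bool" where
  "aperiodic_Bohr0_set _ E \<longleftrightarrow>
     (\<exists>(\<tau> :: int^'N \<Rightarrow> 'k) U. Bohr_data \<tau> U E \<and> connected (UNIV :: 'k set) \<and> 0 \<in> U)"

definition det_patterns :: "nat \<Rightarrow> nat \<Rightarrow> (int^'n^'n) set \<Rightarrow> bool" where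
  "det_patterns k m E \<longleftrightarrow>
     (\<forall>F :: (int^'n^'n) set. F \<subseteq> Sym \<and> finite F \<and> card F = m \<longrightarrow>
        (\<exists>b\<in>E. (\<lambda>f. int k ^ CARD('n) * det f) ` F \<subseteq> det ` (\<lambda>e. e - b) ` E))"

end

theory Submission
  imports Defs "HOL-Analysis.Bounded_Continuous_Function"
begin

text \<open>An invariant mean on bounded functions on \<open>\<int>\<^sup>N\<close> turns these functions into a semi-inner product
  space on which \<open>\<int>\<^sup>N\<close> acts by isometries.  For every \<open>t\<close> there is a polynomial path of symmetric
  matrices of determinant \<open>t\<close>, of a degree independent of \<open>t\<close>, whose non-constant coefficients span
  the lattice of symmetric matrices.  By van der Corput's inequality the averages of translations along
  such a path annihilate everything except the part of \<open>1\<^sub>E\<close> that is periodic under a finite index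
  subgroup.  After multiplication of the path by a suitable \<open>k\<close>, they
  therefore converge, for all \<open>t\<close>, to almost the same \<open>k\<close>-periodic function \<open>g\<close>, a convex combination
  of translates of \<open>1\<^sub>E\<close>.  Hence the mean of \<open>1\<^sub>E\<close> times the
  product of \<open>m\<close> such averages is close to the mean of \<open>1\<^sub>E g\<^sup>m\<close>.  By periodicity of
  \<open>g\<close> this is about the mean of \<open>g g\<^sup>m\<close>, so at least \<open>c\<^sup>m c\<close> where
  \<open>c > 0\<close> is the mean of \<open>1\<^sub>E\<close>.

  For a homomorphism into a connected compact group the same argument is applied to a
  continuous bump function instead of \<open>1\<^sub>E\<close>.  Multiples of \<open>q\<close> still have dense image, so that there is no periodic part
  besides the constants and \<open>k = 1\<close> is allowed: the matrices of determinant \<open>t\<close> have dense image.\<close>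

section \<open>Isometric actions on semi-inner product spaces\<close>

text \<open>The space is never completed, so projections and spectral arguments are replaced by
  convex combinations of translations with error bounds. Such combinations keep what the last step
  needs: they preserve the mean and values in [0, 1], and where one of them makes a non-negative
  function positive, some translate involved is positive.

  The obstacle is that \<open>k\<close> must serve all \<open>F\<close>, hence infinitely many
  paths. In the polynomial mean ergodic estimate the required smallness depends only on the degree
  and the precision. The speed of convergence and an auxiliary dilation of time do depend on the
  path, but only the existence of one good average is used. This is why the degree must not depend
  on the determinant, and why \<open>k\<close> can be fixed before \<open>F\<close>.

  The \<open>m\<close> determinants do not interact: the product of the averages is evaluated at one
  point, which gives \<open>b\<close>, and each factor then picks its own parameter on its own path.
  So single averages suffice, and no multiple ergodic averages occur.\<close>

locale isometric_action =
  fixes ip :: "'v::real_vector \<Rightarrow> 'v \<Rightarrow> real"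
    and U :: "int^'N::finite \<Rightarrow> 'v \<Rightarrow> 'v"
  assumes ip_commute: "ip x y = ip y x"
    and ip_add_left: "ip (x + y) z = ip x z + ip y z"
    and ip_scale_left: "ip (c *\<^sub>R x) y = c * ip x y"
    and ip_nonneg: "0 \<le> ip x x"
    and U_zero: "U 0 x = x"
    and U_plus: "U (a + b) x = U a (U b x)"
    and U_add: "U a (x + y) = U a x + U a y"
    and U_scale: "U a (c *\<^sub>R x) = c *\<^sub>R U a x"
    and ip_U: "ip (U a x) (U a y) = ip x y"
begin

definition nrm :: "'v \<Rightarrow> real" where "nrm x = sqrt (ip x x)"

lemma ip_add_right: "ip x (y + z) = ip x y + ip x z"
  by (metis ip_add_left ip_commute)

lemma ip_scale_right: "ip x (c *\<^sub>R y) = c * ip x y"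
  by (metis ip_scale_left ip_commute)

lemma ip_minus_left: "ip (- x) y = - ip x y"
  using ip_scale_left[of "-1" x y] by simp

lemma ip_minus_right: "ip x (- y) = - ip x y"
  by (metis ip_minus_left ip_commute)

lemma ip_diff_left: "ip (x - y) z = ip x z - ip y z"
  using ip_add_left[of x "- y" z] by (simp add: ip_minus_left)

lemma ip_diff_right: "ip x (y - z) = ip x y - ip x z"
  by (metis ip_diff_left ip_commute)

lemma ip_zero_left [simp]: "ip 0 x = 0"
  using ip_scale_left[of 0 0 x] by simp

lemma ip_zero_right [simp]: "ip x 0 = 0"
  by (metis ip_zero_left ip_commute)

lemmas ip_simps = ip_add_left ip_add_right ip_diff_left ip_diff_right ip_scale_left ip_scale_right
  ip_minus_left ip_minus_right

lemma ip_sum_left: "ip (\<Sum>i\<in>A. f i) y = (\<Sum>i\<in>A. ip (f i) y)"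
  by (induction A rule: infinite_finite_induct) (auto simp: ip_add_left)

lemma ip_sum_right: "ip y (\<Sum>i\<in>A. f i) = (\<Sum>i\<in>A. ip y (f i))"
  by (induction A rule: infinite_finite_induct) (auto simp: ip_add_right)

lemma nrm_nonneg [simp]: "0 \<le> nrm x"
  by (simp add: nrm_def ip_nonneg)

lemma nrm_sq: "(nrm x)\<^sup>2 = ip x x"
  by (simp add: nrm_def ip_nonneg)

lemma nrm_zero [simp]: "nrm 0 = 0"
  by (simp add: nrm_def)

lemma nrm_U [simp]: "nrm (U a x) = nrm x"
  by (simp add: nrm_def ip_U)

lemma nrm_scale: "nrm (c *\<^sub>R x) = \<bar>c\<bar> * nrm x"
  by (simp add: nrm_def ip_simps real_sqrt_mult flip: mult.assoc)

lemma nrm_minus_commute: "nrm (x - y) = nrm (y - x)"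
  using nrm_scale[of "-1" "x - y"] by simp

lemma ip_le_nrm: "\<bar>ip x y\<bar> \<le> nrm x * nrm y"
proof -
  have quad: "0 \<le> ip x x - 2 * c * ip x y + c\<^sup>2 * ip y y" for c
    using ip_nonneg[of "x - c *\<^sub>R y"]
    by (simp add: ip_simps ip_commute[of y x] power2_eq_square algebra_simps)
  have "(ip x y)\<^sup>2 \<le> ip x x * ip y y"
  proof (cases "ip y y = 0")
    case True
    have "ip x y = 0"
    proof (rule ccontr)
      assume "ip x y \<noteq> 0"
      then show False
        using quad[of "(ip x x + 1) / (2 * ip x y)"] True by (simp add: field_simps)
    qed
    with True show ?thesis by simp
  next
    case False
    then have "ip y y > 0" using ip_nonneg[of y] by simp
    then show ?thesis
      using quad[of "ip x y / ip y y"] by (simp add: field_simps power2_eq_square)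
  qed
  then have "sqrt ((ip x y)\<^sup>2) \<le> sqrt (ip x x * ip y y)"
    using real_sqrt_le_mono by blast
  then show ?thesis
    by (simp add: nrm_def real_sqrt_mult)
qed

lemma nrm_triangle: "nrm (x + y) \<le> nrm x + nrm y"
proof (rule power2_le_imp_le)
  have "ip x y \<le> nrm x * nrm y" using ip_le_nrm[of x y] by simp
  then show "(nrm (x + y))\<^sup>2 \<le> (nrm x + nrm y)\<^sup>2"
    by (simp add: power2_sum nrm_sq ip_simps ip_commute[of y x])
qed simp

lemma nrm_triangle_sub: "nrm (x - y) \<le> nrm x + nrm y"
  using nrm_triangle[of x "- y"] nrm_scale[of "-1" y] by simp

lemma nrm_diff_triangle: "nrm (x - z) \<le> nrm (x - y) + nrm (y - z)"
  using nrm_triangle[of "x - y" "y - z"] by simp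

lemma nrm_le_diff: "nrm x \<le> nrm y + nrm (x - y)"
  using nrm_triangle[of y "x - y"] by simp

lemma nrm_sum: "nrm (\<Sum>i\<in>A. f i) \<le> (\<Sum>i\<in>A. nrm (f i))"
proof (induction A rule: infinite_finite_induct)
  case (insert x F)
  then show ?case using nrm_triangle[of "f x" "sum f F"] by auto
qed auto

lemma nrm_convex:
  assumes "0 \<le> t" "t \<le> 1" "nrm x \<le> c" "nrm y \<le> c"
  shows "nrm (t *\<^sub>R x + (1 - t) *\<^sub>R y) \<le> c"
proof -
  have "nrm (t *\<^sub>R x + (1 - t) *\<^sub>R y) \<le> t * nrm x + (1 - t) * nrm y"
    using nrm_triangle[of "t *\<^sub>R x" "(1 - t) *\<^sub>R y"] assms by (simp add: nrm_scale)
  also have "\<dots> \<le> t * c + (1 - t) * c"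
    using assms by (intro add_mono mult_left_mono) auto
  finally show ?thesis by (simp add: algebra_simps)
qed

lemma U_diff: "U a (x - y) = U a x - U a y"
  using U_add[of a x "- y"] U_scale[of a "-1" y] by simp

lemma U_comm: "U a (U b x) = U b (U a x)"
  by (metis U_plus add.commute)

subsection \<open>Convex combinations of translations\<close>

text \<open>These are operators rather than vectors because the same average is applied to several
  vectors, such as \<open>u\<close>, its approximate projection and their difference. Binary
  combinations suffice and reduce every property to a two-case induction.\<close>

inductive_set ops :: "(int^'N) set \<Rightarrow> ('v \<Rightarrow> 'v) set" for H where
  base: "v \<in> H \<Longrightarrow> U v \<in> ops H"
| comb: "A \<in> ops H \<Longrightarrow> B \<in> ops H \<Longrightarrow> 0 \<le> t \<Longrightarrow> t \<le> 1 \<Longrightarrow>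
    (\<lambda>x. t *\<^sub>R A x + (1 - t) *\<^sub>R B x) \<in> ops H"

lemma ops_mono: "A \<in> ops H \<Longrightarrow> H \<subseteq> H' \<Longrightarrow> A \<in> ops H'"
  by (induction rule: ops.induct) (auto intro: ops.intros)

lemma ops_add: "A \<in> ops H \<Longrightarrow> A (x + y) = A x + A y"
  by (induction rule: ops.induct) (auto simp: U_add algebra_simps)

lemma ops_scale: "A \<in> ops H \<Longrightarrow> A (c *\<^sub>R x) = c *\<^sub>R A x"
  by (induction rule: ops.induct) (auto simp: U_scale algebra_simps)

lemma ops_diff: "A \<in> ops H \<Longrightarrow> A (x - y) = A x - A y"
  using ops_add[of A H x "(-1) *\<^sub>R y"] ops_scale[of A H "-1" y] by simp

lemma ops_nrm: "A \<in> ops H \<Longrightarrow> nrm (A x) \<le> nrm x"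
  by (induction rule: ops.induct) (auto intro: nrm_convex)

lemma ops_U_comm: "A \<in> ops H \<Longrightarrow> A (U a x) = U a (A x)"
  by (induction rule: ops.induct) (auto simp: U_comm U_add U_scale)

lemma ops_comm: "A \<in> ops H \<Longrightarrow> B \<in> ops H' \<Longrightarrow> A (B x) = B (A x)"
  by (induction rule: ops.induct) (auto simp: ops_U_comm ops_add ops_scale)

lemma ops_shift:
  "A \<in> ops H \<Longrightarrow> (\<And>x. x \<in> H \<Longrightarrow> v + x \<in> H) \<Longrightarrow> (\<lambda>x. U v (A x)) \<in> ops H"
proof (induction rule: ops.induct)
  case (base a)
  then have "U (v + a) \<in> ops H" by (auto intro: ops.base)
  moreover have "U (v + a) = (\<lambda>x. U v (U a x))" by (auto simp: U_plus)
  ultimately show ?case by simp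
next
  case (comb A B t)
  then show ?case using ops.comb[of "\<lambda>x. U v (A x)" H "\<lambda>x. U v (B x)" t]
    by (simp add: U_add U_scale)
qed

lemma ops_almost_fixed:
  "A \<in> ops H \<Longrightarrow> (\<And>v. v \<in> H \<Longrightarrow> nrm (U v x - x) \<le> e) \<Longrightarrow> nrm (A x - x) \<le> e"
proof (induction rule: ops.induct)
  case (comb A B t)
  have "t *\<^sub>R A x + (1 - t) *\<^sub>R B x - x = t *\<^sub>R (A x - x) + (1 - t) *\<^sub>R (B x - x)"
    by (simp add: algebra_simps)
  then show ?case using comb by (auto intro!: nrm_convex)
qed auto

text \<open>Serves to exchange the allowed translations while watching a single vector;
  \<open>A'\<close> may depend on \<open>x\<close>. Each translation is exchanged at cost
  \<open>e\<close>, and convexity keeps that bound.\<close>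

lemma ops_project:
  assumes "A \<in> ops H" and "\<And>v. v \<in> H \<Longrightarrow> \<exists>a\<in>H1. nrm (U v x - U a x) \<le> e"
  shows "\<exists>A'\<in>ops H1. nrm (A x - A' x) \<le> e"
  using assms
proof (induction rule: ops.induct)
  case (base v)
  then show ?case by (meson ops.base)
next
  case (comb A B t)
  then obtain A' B' where *: "A' \<in> ops H1" "nrm (A x - A' x) \<le> e" "B' \<in> ops H1" "nrm (B x - B' x) \<le> e"
    by blast
  have "(t *\<^sub>R A x + (1 - t) *\<^sub>R B x) - (t *\<^sub>R A' x + (1 - t) *\<^sub>R B' x) =
      t *\<^sub>R (A x - A' x) + (1 - t) *\<^sub>R (B x - B' x)"
    by (simp add: algebra_simps)
  then have "nrm ((t *\<^sub>R A x + (1 - t) *\<^sub>R B x) - (t *\<^sub>R A' x + (1 - t) *\<^sub>R B' x)) \<le> e"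
    using comb * by (auto intro!: nrm_convex)
  moreover have "(\<lambda>x. t *\<^sub>R A' x + (1 - t) *\<^sub>R B' x) \<in> ops H1"
    using * comb by (auto intro: ops.comb)
  ultimately show ?case by (rule bexI[of _ "\<lambda>x. t *\<^sub>R A' x + (1 - t) *\<^sub>R B' x"])
qed

subsection \<open>Approximate projections\<close>

text \<open>In spectral terms, \<open>u\<close> has almost no mass on the characters that have finite order on \<open>H\<close>.\<close>

definition small :: "real \<Rightarrow> (int^'N) set \<Rightarrow> 'v \<Rightarrow> bool" where
  "small e H u \<longleftrightarrow> (\<forall>q::int. q \<noteq> 0 \<longrightarrow> (\<exists>A\<in>ops ((*s) q ` H). nrm (A u) \<le> e))"

text \<open>For a subgroup \<open>H\<close> this is, by the mean ergodic theorem, the norm of the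
  projection of \<open>u\<close> to the \<open>H\<close>-invariant vectors of the
  completion.\<close>

definition hull_dist :: "(int^'N) set \<Rightarrow> 'v \<Rightarrow> real" where
  "hull_dist H u = Inf ((\<lambda>A. nrm (A u)) ` ops H)"

lemma hull_dist_le: "A \<in> ops H \<Longrightarrow> hull_dist H u \<le> nrm (A u)"
  unfolding hull_dist_def by (rule cInf_lower) (auto intro: bdd_belowI[of _ 0])

lemma ops_nonempty: "H \<noteq> {} \<Longrightarrow> ops H \<noteq> {}"
  by (auto intro: ops.base)

lemma hull_dist_nonneg: "H \<noteq> {} \<Longrightarrow> 0 \<le> hull_dist H u"
  unfolding hull_dist_def using ops_nonempty[of H] by (intro cInf_greatest) auto

lemma hull_dist_le_nrm: "H \<noteq> {} \<Longrightarrow> hull_dist H u \<le> nrm u"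
  using hull_dist_le ops_nrm ops_nonempty by (metis all_not_in_conv order_trans)

lemma hull_dist_attained:
  assumes "H \<noteq> {}" "d > 0"
  obtains A where "A \<in> ops H" "nrm (A u) < hull_dist H u + d"
  using cInf_lessD[of "(\<lambda>A. nrm (A u)) ` ops H" "hull_dist H u + d"] assms ops_nonempty[of H]
  unfolding hull_dist_def by auto

text \<open>The parallelogram law forces two almost shortest elements of a convex set to be close.\<close>

lemma almost_shortest_close:
  assumes A: "A \<in> ops H" "nrm (A u) \<le> hull_dist H u + d"
    and B: "B \<in> ops H" "nrm (B u) \<le> hull_dist H u + d"
    and d: "0 \<le> d" "d \<le> 1" and u: "nrm u \<le> 1" and e: "0 \<le> e" "12 * d \<le> e\<^sup>2"
  shows "nrm (A u - B u) \<le> e"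
proof -
  define r where "r = hull_dist H u"
  have H: "H \<noteq> {}" using A(1) by (induction rule: ops.induct) auto
  have r: "0 \<le> r" "r \<le> 1"
    using hull_dist_nonneg[OF H] hull_dist_le_nrm[OF H, of u] u by (auto simp: r_def)
  have "(\<lambda>x. (1/2) *\<^sub>R A x + (1 - 1/2) *\<^sub>R B x) \<in> ops H"
    using A B by (intro ops.comb) auto
  from hull_dist_le[OF this, of u] have "r \<le> nrm ((1/2) *\<^sub>R (A u + B u))"
    by (simp add: r_def scaleR_add_right)
  then have mid: "2 * r \<le> nrm (A u + B u)" by (simp add: nrm_scale)
  have "(2 * r)\<^sup>2 \<le> (nrm (A u + B u))\<^sup>2"
    using mid r by (intro power_mono) auto
  moreover have "(nrm (A u))\<^sup>2 \<le> (r + d)\<^sup>2" "(nrm (B u))\<^sup>2 \<le> (r + d)\<^sup>2"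
    using A B by (auto simp: r_def intro!: power_mono)
  moreover have "(nrm (A u - B u))\<^sup>2 + (nrm (A u + B u))\<^sup>2 = 2 * (nrm (A u))\<^sup>2 + 2 * (nrm (B u))\<^sup>2"
    by (simp add: nrm_sq ip_simps ip_commute[of "B u" "A u"])
  ultimately have "(nrm (A u - B u))\<^sup>2 \<le> 4 * (r + d)\<^sup>2 - (2 * r)\<^sup>2" by linarith
  also have "\<dots> = 8 * r * d + 4 * d * d" by (simp add: power2_eq_square algebra_simps)
  also have "\<dots> \<le> 8 * 1 * d + 4 * 1 * d"
    using r d by (intro add_mono mult_right_mono mult_left_mono) auto
  also have "\<dots> \<le> e\<^sup>2" using e by simp
  finally show ?thesis using e(1) power2_le_imp_le by blast
qed

text \<open>\<open>A u\<close> stands in for the orthogonal projection of \<open>u\<close> onto the vectors fixed by a finite index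
  subgroup of \<open>H\<close>, which need not exist because the space is not assumed to be complete.\<close>

lemma almost_projection_at:
  fixes k :: int
  assumes k: "k \<noteq> 0" and H0: "H \<noteq> {}"
    and Hadd: "\<And>x y. x \<in> H \<Longrightarrow> y \<in> H \<Longrightarrow> x + y \<in> H"
    and Hscale: "\<And>x c. x \<in> H \<Longrightarrow> c *s x \<in> H"
    and u: "nrm u \<le> 1" and e: "0 < e" and d: "0 < d" "2 * d \<le> 1" "24 * d \<le> (e/2)\<^sup>2"
    and stab: "\<And>q. q \<noteq> 0 \<Longrightarrow> k dvd q \<Longrightarrow> hull_dist ((*s) q ` H) u \<le> hull_dist ((*s) k ` H) u + d"
  shows "\<exists>A\<in>ops ((*s) k ` H). (\<forall>v\<in>H. nrm (U (k *s v) (A u) - A u) \<le> e) \<and> small e H (u - A u)"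
proof -
  let ?kH = "(*s) k ` H"
  have sub1: "(*s) (k * q) ` H \<subseteq> ?kH" for q
  proof
    fix x assume "x \<in> (*s) (k * q) ` H"
    then obtain y where y: "y \<in> H" "x = (k * q) *s y" by blast
    have "x = k *s (q *s y)" using y(2) by (simp add: vector_smult_assoc)
    then show "x \<in> ?kH" using Hscale[OF y(1)] by blast
  qed
  have sub2: "(*s) (k * q) ` H \<subseteq> (*s) q ` H" for q
  proof
    fix x assume "x \<in> (*s) (k * q) ` H"
    then obtain y where y: "y \<in> H" "x = (k * q) *s y" by blast
    have "x = q *s (k *s y)" using y(2) by (simp add: vector_smult_assoc mult.commute)
    then show "x \<in> (*s) q ` H" using Hscale[OF y(1)] by blast
  qed
  \<comment> \<open>The bounds on \<open>d\<close> are those of \<open>almost_shortest_close\<close>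
    for excess \<open>2 * d\<close> and distance \<open>e / 2\<close>. One \<open>d\<close> pays for
    nearly attaining an infimum, the other for passing from multiples of \<open>k * q\<close> to
    multiples of \<open>k\<close> by \<open>stab\<close>.\<close>
  have close: "nrm (B u - C u) \<le> e / 2"
    if "B \<in> ops ?kH" "nrm (B u) \<le> hull_dist ?kH u + 2 * d"
       "C \<in> ops ?kH" "nrm (C u) \<le> hull_dist ?kH u + 2 * d" for B C
    by (rule almost_shortest_close[OF that]) (use d e u in auto)
  obtain A where A: "A \<in> ops ?kH" "nrm (A u) < hull_dist ?kH u + d"
    using hull_dist_attained[of ?kH d u] H0 d by auto
  then have A': "nrm (A u) \<le> hull_dist ?kH u + 2 * d" using d by linarith
  \<comment> \<open>The translate of \<open>A u\<close> has the same norm and lies in the same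
    convex set, so it is again almost shortest.\<close>
  have fixd: "nrm (U (k *s v) (A u) - A u) \<le> e / 2" if v: "v \<in> H" for v
  proof -
    have "(\<lambda>x. U (k *s v) (A x)) \<in> ops ?kH"
      using A(1)
    proof (rule ops_shift)
      fix x assume "x \<in> ?kH"
      then obtain y where "y \<in> H" "x = k *s y" by blast
      then show "k *s v + x \<in> ?kH"
        using Hadd[OF v, of y] by (auto simp flip: vector_add_ldistrib)
    qed
    from close[OF this _ A(1) A'] show ?thesis using A' by simp
  qed
  have "\<exists>B\<in>ops ((*s) q ` H). nrm (B (u - A u)) \<le> e" if q: "q \<noteq> 0" for q
  proof -
    have kq: "k * q \<noteq> 0" using k q by simp
    \<comment> \<open>By \<open>stab\<close>, \<open>B u\<close> is almost shortest for
      \<open>k\<close> as well, hence near \<open>A u\<close>; since \<open>B\<close> barely moves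
      \<open>A u\<close>, the vector \<open>B (u - A u)\<close> is small.\<close>
    obtain B where B: "B \<in> ops ((*s) (k * q) ` H)" "nrm (B u) < hull_dist ((*s) (k * q) ` H) u + d"
      using hull_dist_attained[of "(*s) (k * q) ` H" d u] H0 d by auto
    have BkH: "B \<in> ops ?kH" using B(1) sub1 by (rule ops_mono)
    have "nrm (B u) \<le> hull_dist ?kH u + 2 * d" using B(2) stab[OF kq] by simp
    then have 1: "nrm (B u - A u) \<le> e / 2"
      using close BkH A(1) A' by blast
    have 2: "nrm (B (A u) - A u) \<le> e / 2"
      by (rule ops_almost_fixed[OF BkH]) (use fixd in blast)
    have "nrm (B (u - A u)) \<le> nrm (B u - A u) + nrm (A u - B (A u))"
      using nrm_diff_triangle[of "B u" "B (A u)" "A u"] by (simp add: ops_diff[OF B(1)])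
    also have "\<dots> \<le> e" using 1 2 nrm_minus_commute[of "A u" "B (A u)"] by simp
    finally show ?thesis using ops_mono[OF B(1) sub2] by blast
  qed
  then have "small e H (u - A u)" unfolding small_def by blast
  moreover have "\<forall>v\<in>H. nrm (U (k *s v) (A u) - A u) \<le> e"
    using fixd e by fastforce
  ultimately show ?thesis using A(1) by blast
qed

text \<open>The distances are bounded by \<open>nrm u\<close>; choose \<open>k\<close> nearly
  attaining their supremum over the positive integers. Negative \<open>q\<close> give the same set
  of multiples as their absolute value.\<close>

lemma hull_dist_stable:
  assumes H0: "H \<noteq> {}" and Hscale: "\<And>x c. x \<in> H \<Longrightarrow> c *s x \<in> H"
    and u: "nrm u \<le> 1" and d: "0 < d"
  obtains k :: int where "k > 0"
    "\<And>q. q \<noteq> 0 \<Longrightarrow> k dvd q \<Longrightarrow> hull_dist ((*s) q ` H) u \<le> hull_dist ((*s) k ` H) u + d"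
proof -
  let ?S = "(\<lambda>k::int. hull_dist ((*s) k ` H) u) ` {0<..}"
  have bdd: "bdd_above ?S"
  proof (rule bdd_aboveI)
    fix x assume "x \<in> ?S"
    then obtain k :: int where "x = hull_dist ((*s) k ` H) u" by blast
    then show "x \<le> nrm u" using hull_dist_le_nrm[of "(*s) k ` H" u] H0 by simp
  qed
  have "Sup ?S - d < Sup ?S" using d by simp
  then obtain k :: int where k: "k > 0" "Sup ?S - d < hull_dist ((*s) k ` H) u"
    using less_cSupD[of ?S "Sup ?S - d"] by (fastforce simp: image_iff)
  have neg: "(*s) (- q) ` H \<subseteq> (*s) q ` H" for q
  proof
    fix x assume "x \<in> (*s) (- q) ` H"
    then obtain y where y: "y \<in> H" "x = (- q) *s y" by blast
    have "x = q *s ((-1) *s y)" using y(2) by (simp add: vector_smult_assoc)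
    then show "x \<in> (*s) q ` H" using Hscale[OF y(1)] by blast
  qed
  have "hull_dist ((*s) q ` H) u \<le> hull_dist ((*s) k ` H) u + d" if "q \<noteq> 0" for q
  proof -
    have "(*s) q ` H = (*s) \<bar>q\<bar> ` H"
      using neg[of q] neg[of "- q"] by (auto simp: abs_if)
    then have "hull_dist ((*s) q ` H) u \<le> Sup ?S"
      using that by (intro cSup_upper[OF _ bdd]) auto
    then show ?thesis using k by simp
  qed
  then show thesis using that k(1) by blast
qed

lemma almost_projection:
  assumes H0: "H \<noteq> {}" 
    and Hadd: "\<And>x y. x \<in> H \<Longrightarrow> y \<in> H \<Longrightarrow> x + y \<in> H"
    and Hscale: "\<And>x c. x \<in> H \<Longrightarrow> c *s x \<in> H"
    and u: "nrm u \<le> 1" and e: "0 < e"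
  obtains k :: int and A where "k > 0" "A \<in> ops ((*s) k ` H)"
    "\<And>v. v \<in> H \<Longrightarrow> nrm (U (k *s v) (A u) - A u) \<le> e" "small e H (u - A u)"
proof -
  define d where "d = min (1/2) ((e/2)\<^sup>2 / 24)"
  have d: "0 < d" "2 * d \<le> 1" "24 * d \<le> (e/2)\<^sup>2" using e by (auto simp: d_def min_def)
  obtain k :: int where k: "k > 0"
    "\<And>q. q \<noteq> 0 \<Longrightarrow> k dvd q \<Longrightarrow> hull_dist ((*s) q ` H) u \<le> hull_dist ((*s) k ` H) u + d"
    using hull_dist_stable[OF H0 Hscale u d(1)] by blast
  from almost_projection_at[OF _ H0 Hadd Hscale u e d k(2)] k(1) that show thesis
    by auto
qed

end

section \<open>Polynomial paths in the lattice and their differences\<close>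

lemma power_diff_expansion:
  fixes a b :: int
  obtains e :: "nat \<Rightarrow> int" where "e D = int (Suc D) * (a - b)"
    "\<And>x. (x + a) ^ Suc D - (x + b) ^ Suc D = (\<Sum>i\<le>D. x ^ i * e i)"
proof -
  define e where "e i = int (Suc D choose i) * (a ^ (Suc D - i) - b ^ (Suc D - i))" for i
  have "(x + a) ^ Suc D - (x + b) ^ Suc D = (\<Sum>i\<le>D. x ^ i * e i)" for x
  proof -
    have "(x + c) ^ Suc D = (\<Sum>i\<le>D. int (Suc D choose i) * x ^ i * c ^ (Suc D - i)) + x ^ Suc D" for c
      by (subst binomial_ring) (simp add: sum.atMost_Suc del: binomial_Suc_Suc power_Suc)
    then show ?thesis
      by (simp only:) (simp add: e_def algebra_simps del: binomial_Suc_Suc power_Suc flip: sum_subtractf)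
  qed
  moreover have "e D = int (Suc D) * (a - b)"
    by (simp add: e_def)
  ultimately show thesis using that by blast
qed

lemma vector_smult_sum_left: "(\<Sum>i\<in>A. f i) *s x = (\<Sum>i\<in>A. f i *s (x :: 'a::semiring_0^'n))"
  by (simp add: vec_eq_iff sum_distrib_right)

lemma vector_smult_sum_right: "c *s (\<Sum>i\<in>A. f i) = (\<Sum>i\<in>A. c *s (f i :: 'a::semiring_0^'n))"
  by (simp add: vec_eq_iff sum_distrib_left)

text \<open>One differencing step for van der Corput's inequality. For \<open>a \<noteq> b\<close>
  the new leading coefficient is a non-zero multiple of the old one, so smallness in its direction
  is passed on.\<close>

lemma poly_path_diff:
  fixes w :: "nat \<Rightarrow> int^'N" and a b :: int
  shows "\<exists>w'. w' D = (int (Suc D) * (a - b)) *s w (Suc D) \<and>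
    (\<forall>x. (\<Sum>m\<le>Suc D. (x + a) ^ m *s w m) - (\<Sum>m\<le>Suc D. (x + b) ^ m *s w m) = (\<Sum>i\<le>D. x ^ i *s w' i))"
proof (induction D)
  case 0
  show ?case
    by (rule exI[of _ "\<lambda>_. (a - b) *s w 1"]) (simp add: vector_sadd_rdistrib vec_eq_iff algebra_simps)
next
  case (Suc D)
  then obtain w' where w': "w' D = (int (Suc D) * (a - b)) *s w (Suc D)"
    "\<And>x. (\<Sum>m\<le>Suc D. (x + a) ^ m *s w m) - (\<Sum>m\<le>Suc D. (x + b) ^ m *s w m) = (\<Sum>i\<le>D. x ^ i *s w' i)"
    by blast
  obtain e where e: "e (Suc D) = int (Suc (Suc D)) * (a - b)"
    "\<And>x. (x + a) ^ Suc (Suc D) - (x + b) ^ Suc (Suc D) = (\<Sum>i\<le>Suc D. x ^ i * e i)"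
    using power_diff_expansion[of "Suc D" a b] by blast
  define w'' where "w'' i = (if i \<le> D then w' i else 0) + e i *s w (Suc (Suc D))" for i
  have "(\<Sum>m\<le>Suc (Suc D). (x + a) ^ m *s w m) - (\<Sum>m\<le>Suc (Suc D). (x + b) ^ m *s w m) =
      (\<Sum>i\<le>Suc D. x ^ i *s w'' i)" for x
  proof -
    have "(\<Sum>m\<le>Suc (Suc D). (x + a) ^ m *s w m) - (\<Sum>m\<le>Suc (Suc D). (x + b) ^ m *s w m) =
        ((\<Sum>m\<le>Suc D. (x + a) ^ m *s w m) - (\<Sum>m\<le>Suc D. (x + b) ^ m *s w m)) +
        ((x + a) ^ Suc (Suc D) - (x + b) ^ Suc (Suc D)) *s w (Suc (Suc D))"
      by (simp only: sum.atMost_Suc[of _ "Suc D"] vector_sub_rdistrib) (simp add: algebra_simps)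
    also have "\<dots> = (\<Sum>i\<le>D. x ^ i *s w' i) + (\<Sum>i\<le>Suc D. (x ^ i * e i) *s w (Suc (Suc D)))"
      by (simp only: w'(2) e(2) vector_smult_sum_left)
    also have "(\<Sum>i\<le>D. x ^ i *s w' i) = (\<Sum>i\<le>Suc D. x ^ i *s (if i \<le> D then w' i else 0))"
      by simp
    finally show ?thesis
      by (simp only: w''_def vector_add_ldistrib sum.distrib vector_smult_assoc)
  qed
  moreover have "w'' (Suc D) = (int (Suc (Suc D)) * (a - b)) *s w (Suc (Suc D))"
    by (simp add: w''_def e(1))
  ultimately show ?case by blast
qed

definition poly_path :: "nat \<Rightarrow> (nat \<Rightarrow> int^'N::finite) \<Rightarrow> int \<Rightarrow> int^'N" where
  "poly_path D w x = (\<Sum>m\<le>D. x ^ m *s w m)"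

text \<open>The constant coefficient is left out: it moves the whole path by one isometry and does
  not change the norm of an average.\<close>

definition zspan :: "nat \<Rightarrow> (nat \<Rightarrow> int^'N::finite) \<Rightarrow> (int^'N) set" where
  "zspan D w = range (\<lambda>a. \<Sum>m=1..D. a m *s w m)"

lemma zspan_0: "zspan 0 w = {0}"
  by (auto simp: zspan_def)

lemma zspan_Suc_E:
  assumes "x \<in> zspan (Suc D) w"
  obtains y j where "y \<in> zspan D w" "x = y + j *s w (Suc D)"
  using assms unfolding zspan_def by auto

context isometric_action
begin

subsection \<open>Averages along polynomial paths\<close>

definition avg :: "nat \<Rightarrow> (nat \<Rightarrow> 'v) \<Rightarrow> 'v" where
  "avg N z = (1 / real N) *\<^sub>R (\<Sum>n<N. z n)"

lemma avg_add: "avg N (\<lambda>n. y n + z n) = avg N y + avg N z"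
  by (simp add: avg_def sum.distrib scaleR_add_right)

lemma avg_scale: "avg N (\<lambda>n. c *\<^sub>R z n) = c *\<^sub>R avg N z"
  by (simp add: avg_def scaleR_sum_right mult.commute)

lemma avg_diff: "avg N (\<lambda>n. y n - z n) = avg N y - avg N z"
  by (simp add: avg_def sum_subtractf scaleR_diff_right)

lemma nrm_avg_le:
  assumes "\<And>n. n < N \<Longrightarrow> nrm (z n) \<le> c" "0 \<le> c" shows "nrm (avg N z) \<le> c"
proof (cases "N = 0")
  case True
  then show ?thesis using assms by (simp add: avg_def)
next
  case False
  have "nrm (\<Sum>n<N. z n) \<le> (\<Sum>n<N. nrm (z n))" by (rule nrm_sum)
  also have "\<dots> \<le> (\<Sum>n<N. c)" using assms by (intro sum_mono) auto
  finally show ?thesis using False by (simp add: avg_def nrm_scale field_simps)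
qed

lemma avg_in_ops: "N > 0 \<Longrightarrow> \<exists>A\<in>ops (range p). \<forall>u. A u = avg N (\<lambda>n. U (p n) u)"
proof (induction N)
  case (Suc N)
  show ?case
  proof (cases "N = 0")
    case True
    then show ?thesis by (intro bexI[of _ "U (p 0)"]) (auto simp: avg_def intro: ops.base)
  next
    case False
    then obtain A where A: "A \<in> ops (range p)" "\<And>u. A u = avg N (\<lambda>n. U (p n) u)"
      using Suc by blast
    define t where "t = real N / real (Suc N)"
    have t: "0 \<le> t" "t \<le> 1" "1 - t = 1 / real (Suc N)" by (auto simp: t_def field_simps)
    have "(\<lambda>u. t *\<^sub>R A u + (1 - t) *\<^sub>R U (p N) u) \<in> ops (range p)"
      using A(1) t by (intro ops.comb ops.base) auto
    moreover have "t *\<^sub>R A u + (1 - t) *\<^sub>R U (p N) u = avg (Suc N) (\<lambda>n. U (p n) u)" for u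
      using False by (simp only: t(3)) (simp add: A(2) avg_def t_def scaleR_add_right)
    ultimately show ?thesis by (intro bexI) auto
  qed
qed simp

text \<open>A shift by one step telescopes: one term leaves and one enters, each of norm at most
  \<open>b\<close>.\<close>

lemma avg_shift:
  assumes "\<And>n. nrm (z n) \<le> b"
  shows "nrm (avg N (\<lambda>n. z (n + h)) - avg N z) \<le> 2 * real h * b / real N"
proof (induction h)
  case (Suc h)
  have "(\<Sum>n<N. z (n + Suc h)) - (\<Sum>n<N. z (n + h)) = z (N + h) - z h"
    using sum_lessThan_telescope[of "\<lambda>n. z (n + h)" N] by (simp flip: sum_subtractf)
  then have "avg N (\<lambda>n. z (n + Suc h)) - avg N (\<lambda>n. z (n + h)) = (1 / real N) *\<^sub>R (z (N + h) - z h)"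
    by (simp add: avg_def flip: scaleR_diff_right)
  moreover have "nrm (z (N + h) - z h) \<le> 2 * b"
    using nrm_triangle_sub[of "z (N + h)" "z h"] assms[of "N + h"] assms[of h] by simp
  ultimately have "nrm (avg N (\<lambda>n. z (n + Suc h)) - avg N (\<lambda>n. z (n + h))) \<le> 2 * b / real N"
    by (simp add: nrm_scale divide_right_mono)
  then show ?case
    using Suc nrm_diff_triangle[of "avg N (\<lambda>n. z (n + Suc h))" "avg N z" "avg N (\<lambda>n. z (n + h))"]
    by (simp add: add_divide_distrib algebra_simps)
qed simp

lemma avg_swap: "avg N (\<lambda>n. avg H (\<lambda>h. z n h)) = avg H (\<lambda>h. avg N (\<lambda>n. z n h))"
proof -
  have "avg N (\<lambda>n. avg H (\<lambda>h. z n h)) = (1 / (real N * real H)) *\<^sub>R (\<Sum>n<N. \<Sum>h<H. z n h)"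
    by (simp add: avg_def flip: scaleR_sum_right)
  also have "\<dots> = (1 / (real N * real H)) *\<^sub>R (\<Sum>h<H. \<Sum>n<N. z n h)"
    by (subst sum.swap) simp
  also have "\<dots> = avg H (\<lambda>h. avg N (\<lambda>n. z n h))"
    by (simp add: avg_def mult.commute flip: scaleR_sum_right)
  finally show ?thesis .
qed

text \<open>The variance of the vectors \<open>y n\<close> is non-negative.\<close>

lemma nrm_avg_sq_le: "(nrm (avg N y))\<^sup>2 \<le> (\<Sum>n<N. ip (y n) (y n)) / real N"
proof (cases "N = 0")
  case False
  let ?m = "avg N y"
  have m: "(\<Sum>n<N. y n) = real N *\<^sub>R ?m" using False by (simp add: avg_def)
  have "0 \<le> (\<Sum>n<N. ip (y n - ?m) (y n - ?m))" by (intro sum_nonneg ip_nonneg)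
  also have "\<dots> = (\<Sum>n<N. ip (y n) (y n)) - ip (\<Sum>n<N. y n) ?m - ip ?m (\<Sum>n<N. y n) + real N * ip ?m ?m"
    by (simp add: ip_diff_left ip_diff_right sum.distrib sum_subtractf ip_sum_left ip_sum_right algebra_simps)
  also have "\<dots> = (\<Sum>n<N. ip (y n) (y n)) - real N * ip ?m ?m"
    by (simp add: m ip_simps)
  finally show ?thesis using False by (simp add: nrm_sq field_simps)
qed (simp add: avg_def)

text \<open>Replacing \<open>z n\<close> by its average over a window of length \<open>H\<close>
  costs at most \<open>2 * real H * b / real N\<close>. After convexity of the square, the
  \<open>H\<close> diagonal correlations contribute \<open>b\<^sup>2 / real H\<close> and the others
  at most \<open>d\<close>.\<close>

lemma van_der_Corput:
  assumes z: "\<And>n. nrm (z n) \<le> b" and b: "b > 0" and H: "H > 0" and d: "d > 0" "e > 0"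
    and corr: "\<And>h h'. h < H \<Longrightarrow> h' < H \<Longrightarrow> h \<noteq> h' \<Longrightarrow>
      eventually (\<lambda>N. (\<Sum>n<N. ip (z (n + h)) (z (n + h'))) / real N \<le> d) sequentially"
  shows "eventually (\<lambda>N. nrm (avg N z) \<le> sqrt (b\<^sup>2 / real H + d) + e) sequentially"
proof -
  have ev1: "eventually (\<lambda>N. \<forall>h\<in>{..<H}. \<forall>h'\<in>{..<H}. h \<noteq> h' \<longrightarrow>
      (\<Sum>n<N. ip (z (n + h)) (z (n + h'))) / real N \<le> d) sequentially"
  proof (intro eventually_ball_finite ballI)
    fix h h' assume "h \<in> {..<H}" "h' \<in> {..<H}"
    then show "eventually (\<lambda>N. h \<noteq> h' \<longrightarrow>
      (\<Sum>n<N. ip (z (n + h)) (z (n + h'))) / real N \<le> d) sequentially"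
      using corr[of h h'] by (cases "h = h'") auto
  qed auto
  have "(\<lambda>N. 2 * real H * b / real N) \<longlonglongrightarrow> 0"
    by (rule lim_const_over_n)
  then have ev2: "eventually (\<lambda>N. 2 * real H * b / real N < e) sequentially"
    using d by (auto dest: order_tendstoD)
  show ?thesis
    using ev1 ev2 eventually_gt_at_top[of 0]
  proof eventually_elim
    case (elim N)
    let ?y = "\<lambda>n. avg H (\<lambda>h. z (n + h))"
    have "avg N ?y - avg N z = avg H (\<lambda>h. avg N (\<lambda>n. z (n + h)) - avg N z)"
      unfolding avg_diff avg_swap[of N H "\<lambda>n h. z (n + h)"] using H by (simp add: avg_def[of H "\<lambda>_. avg N z"] sum_constant_scaleR)
    moreover have "nrm (avg H (\<lambda>h. avg N (\<lambda>n. z (n + h)) - avg N z)) \<le> 2 * real H * b / real N"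
    proof (rule nrm_avg_le)
      fix h assume "h < H"
      then have "2 * real h * b / real N \<le> 2 * real H * b / real N"
        using b by (intro divide_right_mono mult_right_mono) auto
      with avg_shift[of z b N h, OF z]
      show "nrm (avg N (\<lambda>n. z (n + h)) - avg N z) \<le> 2 * real H * b / real N" by linarith
    qed (use b in auto)
    ultimately have 1: "nrm (avg N z - avg N ?y) \<le> e"
      using elim(2) nrm_minus_commute[of "avg N z" "avg N ?y"] by simp
    have "(nrm (avg N ?y))\<^sup>2 \<le> (\<Sum>n<N. ip (?y n) (?y n)) / real N"
      by (rule nrm_avg_sq_le)
    also have "\<dots> = (\<Sum>n<N. \<Sum>h<H. \<Sum>h'<H. ip (z (n + h)) (z (n + h'))) / real N / (real H)\<^sup>2"
      by (simp add: avg_def ip_scale_left ip_scale_right ip_sum_left ip_sum_right power2_eq_square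
          flip: sum_divide_distrib) (simp add: mult.commute, rule disjI2, rule disjI2, rule sum.cong[OF refl], rule sum.swap)
    also have "(\<Sum>n<N. \<Sum>h<H. \<Sum>h'<H. ip (z (n + h)) (z (n + h'))) =
        (\<Sum>h<H. \<Sum>h'<H. \<Sum>n<N. ip (z (n + h)) (z (n + h')))"
      by (subst sum.swap, rule sum.cong[OF refl], rule sum.swap)
    also have "\<dots> / real N = (\<Sum>h<H. \<Sum>h'<H. (\<Sum>n<N. ip (z (n + h)) (z (n + h'))) / real N)"
      by (simp add: sum_divide_distrib)
    also have "\<dots> / (real H)\<^sup>2 \<le> (\<Sum>h<H. \<Sum>h'<H. (if h = h' then b\<^sup>2 else 0) + d) / (real H)\<^sup>2"
    proof (intro divide_right_mono sum_mono)
      fix h h' assume hh: "h \<in> {..<H}" "h' \<in> {..<H}"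
      show "(\<Sum>n<N. ip (z (n + h)) (z (n + h'))) / real N \<le> (if h = h' then b\<^sup>2 else 0) + d"
      proof (cases "h = h'")
        case True
        have "(\<Sum>n<N. ip (z (n + h)) (z (n + h))) \<le> (\<Sum>n<N. b\<^sup>2)"
        proof (rule sum_mono)
          fix n show "ip (z (n + h)) (z (n + h)) \<le> b\<^sup>2"
            using power_mono[OF z[of "n + h"] nrm_nonneg, of 2] by (simp add: nrm_sq)
        qed
        then have "(\<Sum>n<N. ip (z (n + h)) (z (n + h'))) / real N \<le> b\<^sup>2"
          using True elim by (simp add: field_simps)
        then show ?thesis using True d by simp
      next
        case False
        then show ?thesis using elim(1) hh by auto
      qed
    qed simp
    also have "(\<Sum>h<H. \<Sum>h'<H. (if h = h' then b\<^sup>2 else 0) + d) = real H * b\<^sup>2 + (real H)\<^sup>2 * d"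
      by (simp add: sum.distrib power2_eq_square algebra_simps)
    also have "\<dots> / (real H)\<^sup>2 = b\<^sup>2 / real H + d"
      using H by (simp add: field_simps power2_eq_square)
    finally have "nrm (avg N ?y) \<le> sqrt (b\<^sup>2 / real H + d)"
      by (rule real_le_rsqrt)
    then show ?case using 1 nrm_le_diff[of "avg N z" "avg N ?y"] by linarith
  qed
qed

lemma ip_avg_left: "ip (avg N z) y = (\<Sum>n<N. ip (z n) y) / real N"
  by (simp add: avg_def ip_scale_left ip_sum_left)

text \<open>The coboundary half of the mean ergodic theorem: translation by
  \<open>c *s (j *s v)\<close> is \<open>j\<close> steps along the path, so the sum for
  \<open>u - U x u\<close> telescopes, and convex combinations inherit this.\<close>

lemma avg_linear_path_tendsto:
  assumes "A \<in> ops ((*s) c ` range (\<lambda>j. j *s v))"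
  shows "(\<lambda>N. nrm (avg N (\<lambda>n. U (a + int n *s (c *s v)) (u - A u)))) \<longlonglongrightarrow> 0"
  using assms
proof (induction rule: ops.induct)
  case (base x)
  then obtain j where "x = c *s (j *s v)" by blast
  then have x: "x = j *s (c *s v)" by (simp add: vector_smult_assoc mult.commute)
  \<comment> \<open>The offset \<open>min 0 j\<close> handles both signs of \<open>j\<close>: one of
    the shifts \<open>nat (- j)\<close> and \<open>nat j\<close> is 0, and both indices stay natural
    numbers.\<close>
  define z where "z n = U (a + (int n + min 0 j) *s (c *s v)) u" for n
  have *: "U (a + int n *s (c *s v)) (u - U x u) = z (n + nat (- j)) - z (n + nat j)" for n
    by (simp add: U_diff z_def x flip: U_plus) (auto simp: vec_eq_iff algebra_simps min_def intro!: arg_cong2[of _ _ _ _ "(-)"] arg_cong2[of _ _ _ _ U])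
  have "nrm (avg N (\<lambda>n. U (a + int n *s (c *s v)) (u - U x u))) \<le>
      (2 * real (nat (- j)) * nrm u + 2 * real (nat j) * nrm u) / real N" for N
  proof -
    have "nrm (avg N (\<lambda>n. z (n + nat (- j))) - avg N (\<lambda>n. z (n + nat j))) \<le>
       nrm (avg N (\<lambda>n. z (n + nat (- j))) - avg N z) + nrm (avg N z - avg N (\<lambda>n. z (n + nat j)))"
      by (rule nrm_diff_triangle)
    also have "\<dots> \<le> 2 * real (nat (- j)) * nrm u / real N + 2 * real (nat j) * nrm u / real N"
      unfolding nrm_minus_commute[of "avg N z"] by (intro add_mono avg_shift) (auto simp: z_def)
    finally show ?thesis by (simp only: * avg_diff add_divide_distrib)
  qed
  then show ?case
    by (intro tendsto_sandwich[OF _ _ tendsto_const lim_const_over_n] always_eventually allI) simp_all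
next
  case (comb A B t)
  let ?z = "\<lambda>A n. U (a + int n *s (c *s v)) (u - A u)"
  have "u - (t *\<^sub>R A u + (1 - t) *\<^sub>R B u) = t *\<^sub>R (u - A u) + (1 - t) *\<^sub>R (u - B u)"
    by (simp add: algebra_simps)
  then have "avg N (?z (\<lambda>x. t *\<^sub>R A x + (1 - t) *\<^sub>R B x)) = t *\<^sub>R avg N (?z A) + (1 - t) *\<^sub>R avg N (?z B)" for N
    by (simp add: U_add U_scale avg_add avg_scale)
  then have le: "nrm (avg N (?z (\<lambda>x. t *\<^sub>R A x + (1 - t) *\<^sub>R B x))) \<le> nrm (avg N (?z A)) + nrm (avg N (?z B))" for N
    using comb.hyps(3,4) nrm_triangle[of "t *\<^sub>R avg N (?z A)" "(1 - t) *\<^sub>R avg N (?z B)"]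
      mult_left_le_one_le[of "nrm (avg N (?z A))" t] mult_left_le_one_le[of "nrm (avg N (?z B))" "1 - t"]
    by (simp add: nrm_scale)
  have lim: "(\<lambda>N. nrm (avg N (?z A)) + nrm (avg N (?z B))) \<longlonglongrightarrow> 0"
    using tendsto_add[OF comb.IH] by simp
  show ?case
    by (rule tendsto_sandwich[OF always_eventually always_eventually tendsto_const lim])
      (use le in auto)
qed

text \<open>Van der Corput's inequality replaces the path by its differences, which lowers the degree while
  the leading coefficient remains a non-zero multiple of \<open>v\<close>; the linear case is the mean ergodic theorem.\<close>

lemma path_avg_small_top:
  "0 < \<eta> \<Longrightarrow> \<exists>\<epsilon>>0. \<forall>w v u c. c \<noteq> 0 \<longrightarrow> w (Suc D) = c *s v \<longrightarrow> nrm u \<le> 2 \<longrightarrow>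
    small \<epsilon> (range (\<lambda>j. j *s v)) u \<longrightarrow>
    eventually (\<lambda>N. nrm (avg N (\<lambda>n. U (poly_path (Suc D) w (int n)) u)) \<le> \<eta>) sequentially"
proof (induction D arbitrary: \<eta>)
  case 0
  have "eventually (\<lambda>N. nrm (avg N (\<lambda>n. U (poly_path (Suc 0) w (int n)) u)) \<le> \<eta>) sequentially"
    if c: "c \<noteq> 0" "w (Suc 0) = c *s v" and sm: "small (\<eta>/2) (range (\<lambda>j. j *s v)) u" for w v u c
  proof -
    obtain A where A: "A \<in> ops ((*s) c ` range (\<lambda>j. j *s v))" "nrm (A u) \<le> \<eta>/2"
      using c sm unfolding small_def by blast
    have p: "poly_path (Suc 0) w (int n) = w 0 + int n *s (c *s v)" for n
      using c(2) by (simp add: poly_path_def)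
    have "eventually (\<lambda>N. nrm (avg N (\<lambda>n. U (w 0 + int n *s (c *s v)) (u - A u))) < \<eta>/2) sequentially"
      by (rule order_tendstoD(2)[OF avg_linear_path_tendsto[OF A(1)]]) (use 0 in simp)
    then show ?thesis
    proof eventually_elim
      case (elim N)
      let ?z = "\<lambda>u n. U (w 0 + int n *s (c *s v)) u"
      have "nrm (avg N (?z (A u))) \<le> \<eta>/2" using A(2) 0 by (intro nrm_avg_le) auto
      moreover have "avg N (?z u) = avg N (?z (u - A u)) + avg N (?z (A u))"
        by (simp add: U_diff flip: avg_add)
      ultimately show ?case
        using nrm_triangle[of "avg N (?z (u - A u))" "avg N (?z (A u))"] elim by (simp add: p)
    qed
  qed
  then show ?case using 0 by (intro exI[of _ "\<eta>/2"]) auto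
next
  case (Suc D)
  \<comment> \<open>Correlations are at most \<open>2 * \<eta>'\<close>, that is
    \<open>\<eta>\<^sup>2 / 8\<close>, because \<open>nrm u \<le> 2\<close>; \<open>H\<close> is
    chosen to make \<open>2\<^sup>2 / real H\<close> at most the same. The square root is then at
    most \<open>\<eta> / 2\<close>. The bound 2 on \<open>u\<close> is there because the lemma gets
    applied to differences \<open>u - A u\<close> of vectors of norm at most 1.\<close>
  define \<eta>' where "\<eta>' = \<eta>\<^sup>2 / 16"
  have \<eta>': "\<eta>' > 0" using Suc.prems by (simp add: \<eta>'_def)
  from Suc.IH[OF this] obtain \<epsilon> where \<epsilon>: "\<epsilon> > 0" and
    "\<forall>w v u c. c \<noteq> 0 \<longrightarrow> w (Suc D) = c *s v \<longrightarrow> nrm u \<le> 2 \<longrightarrow> small \<epsilon> (range (\<lambda>j. j *s v)) u \<longrightarrow>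
      eventually (\<lambda>N. nrm (avg N (\<lambda>n. U (poly_path (Suc D) w (int n)) u)) \<le> \<eta>') sequentially"
    by (elim exE conjE) (rule that)
  note IH = this(2)[rule_format]
  obtain H :: nat where H0: "32 / \<eta>\<^sup>2 < real H" using reals_Archimedean2 by blast
  have "0 < 32 / \<eta>\<^sup>2" using Suc.prems by simp
  then have H: "H > 0" using H0 by (cases H) auto
  have H4: "2\<^sup>2 / real H \<le> \<eta>\<^sup>2 / 8"
    using H0 H Suc.prems by (simp add: field_simps)
  have "eventually (\<lambda>N. nrm (avg N (\<lambda>n. U (poly_path (Suc (Suc D)) w (int n)) u)) \<le> \<eta>) sequentially"
    if c: "c \<noteq> 0" "w (Suc (Suc D)) = c *s v" and u: "nrm u \<le> 2" "small \<epsilon> (range (\<lambda>j. j *s v)) u" for w v u c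
  proof -
    let ?p = "poly_path (Suc (Suc D)) w"
    let ?z = "\<lambda>n. U (?p (int n)) u"
    have "eventually (\<lambda>N. nrm (avg N ?z) \<le> sqrt (2\<^sup>2 / real H + \<eta>\<^sup>2/8) + \<eta>/2) sequentially"
    proof (rule van_der_Corput)
      fix h h' :: nat assume hh: "h \<noteq> h'"
      obtain w' where w': "w' (Suc D) = (int (Suc (Suc D)) * (int h - int h')) *s w (Suc (Suc D))"
        "\<And>x. ?p (x + int h) - ?p (x + int h') = poly_path (Suc D) w' x"
        using poly_path_diff[of "Suc D" "int h" "int h'" w] unfolding poly_path_def by blast
      have "eventually (\<lambda>N. nrm (avg N (\<lambda>n. U (poly_path (Suc D) w' (int n)) u)) \<le> \<eta>') sequentially"
        by (rule IH[of "int (Suc (Suc D)) * (int h - int h') * c" _ v])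
          (use hh c u w'(1) in \<open>auto simp: vector_smult_assoc\<close>)
      then show "eventually (\<lambda>N. (\<Sum>n<N. ip (?z (n + h)) (?z (n + h'))) / real N \<le> \<eta>\<^sup>2/8) sequentially"
      proof eventually_elim
        case (elim N)
        \<comment> \<open>Cancelling the common isometry leaves the difference path, so the
          correlation is an inner product of \<open>u\<close> with an average of lower
          degree.\<close>
        have "ip (?z (n + h)) (?z (n + h')) = ip (U (poly_path (Suc D) w' (int n)) u) u" for n
        proof -
          have "?p (int (n + h)) = ?p (int (n + h')) + poly_path (Suc D) w' (int n)"
            unfolding w'(2)[symmetric] by simp
          then show ?thesis by (simp add: U_plus ip_U)
        qed
        then have "(\<Sum>n<N. ip (?z (n + h)) (?z (n + h'))) / real N =
            ip (avg N (\<lambda>n. U (poly_path (Suc D) w' (int n)) u)) u"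
          by (simp add: ip_avg_left)
        also have "\<dots> \<le> nrm (avg N (\<lambda>n. U (poly_path (Suc D) w' (int n)) u)) * nrm u"
          using ip_le_nrm abs_le_D1 by blast
        also have "\<dots> \<le> \<eta>' * 2"
          using elim u \<eta>' by (intro mult_mono) auto
        finally show ?case by (simp add: \<eta>'_def)
      qed
    qed (use u H Suc.prems in auto)
    moreover have "sqrt (2\<^sup>2 / real H + \<eta>\<^sup>2/8) + \<eta>/2 \<le> \<eta>"
    proof -
      have "sqrt (2\<^sup>2 / real H + \<eta>\<^sup>2/8) \<le> \<eta>/2"
        using H4 Suc.prems by (intro real_le_lsqrt) (auto simp: power2_eq_square field_simps)
      then show ?thesis by simp
    qed
    ultimately show ?thesis by (auto elim!: eventually_mono)
  qed
  then show ?case using \<epsilon> by blast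
qed

text \<open>Induction on the degree: the top coefficient handles the part of \<open>u\<close> without almost periods in its
  direction, and on the remaining part the top coefficient has no effect along multiples of a period.\<close>

lemma path_avg_small:
  "0 < \<eta> \<Longrightarrow> \<exists>\<epsilon>>0. \<forall>w u. nrm u \<le> 1 \<longrightarrow> small \<epsilon> (zspan D w) u \<longrightarrow>
    (\<exists>Q>0. \<forall>Q'>0. Q dvd Q' \<longrightarrow>
      eventually (\<lambda>N. nrm (avg N (\<lambda>n. U (poly_path D w (Q' * int n)) u)) \<le> \<eta>) sequentially)"
proof (induction D arbitrary: \<eta>)
  case 0
  \<comment> \<open>Only the zero translation is available here, so averaging does not shorten
    \<open>u\<close> and smallness bounds \<open>u\<close> itself.\<close>
  have "nrm u \<le> \<eta>" if sm: "small \<eta> (zspan 0 w) u" for w u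
  proof -
    obtain A where A: "A \<in> ops {0}" "nrm (A u) \<le> \<eta>"
      using sm[unfolded small_def zspan_0, rule_format, of 1] by auto
    have "nrm (A u - u) \<le> 0" using A(1) by (rule ops_almost_fixed) (simp add: U_zero)
    then show ?thesis using A(2) nrm_le_diff[of u "A u"] by (simp add: nrm_minus_commute)
  qed
  then have "eventually (\<lambda>N. nrm (avg N (\<lambda>n. U (poly_path 0 w (Q' * int n)) u)) \<le> \<eta>) sequentially"
    if "small \<eta> (zspan 0 w) u" for w u Q'
    using that 0 by (intro always_eventually allI nrm_avg_le) auto
  then show ?case using 0 by (intro exI[of _ \<eta>]) (auto intro: exI[of _ 1])
next
  case (Suc D)
  have \<eta>3: "\<eta>/3 > 0" using Suc.prems by simp
  from path_avg_small_top[OF this, of D] obtain \<epsilon>1 where \<epsilon>1: "\<epsilon>1 > 0" and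
    "\<forall>w v u c. c \<noteq> 0 \<longrightarrow> w (Suc D) = c *s v \<longrightarrow> nrm u \<le> 2 \<longrightarrow> small \<epsilon>1 (range (\<lambda>j. j *s v)) u \<longrightarrow>
      eventually (\<lambda>N. nrm (avg N (\<lambda>n. U (poly_path (Suc D) w (int n)) u)) \<le> \<eta>/3) sequentially"
    by (elim exE conjE) (rule that)
  note top = this(2)[rule_format]
  from Suc.IH[OF \<eta>3] obtain \<epsilon>2 where \<epsilon>2: "\<epsilon>2 > 0" and
    "\<forall>w u. nrm u \<le> 1 \<longrightarrow> small \<epsilon>2 (zspan D w) u \<longrightarrow>
    (\<exists>Q>0. \<forall>Q'>0. Q dvd Q' \<longrightarrow>
      eventually (\<lambda>N. nrm (avg N (\<lambda>n. U (poly_path D w (Q' * int n)) u)) \<le> \<eta>/3) sequentially)"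
    by (elim exE conjE) (rule that)
  note IH = this(2)[rule_format]
  \<comment> \<open>\<open>\<epsilon>1\<close> is for the part \<open>u - A u\<close>,
    \<open>\<epsilon>2 / 2\<close> leaves room for a projection error in the smallness of
    \<open>A u\<close>, and \<open>\<eta> / 3\<close> bounds the effect of the top coefficient on
    \<open>A u\<close>.\<close>
  define \<epsilon> where "\<epsilon> = min \<epsilon>1 (min (\<epsilon>2/2) (\<eta>/3))"
  have \<epsilon>: "\<epsilon> > 0" "\<epsilon> \<le> \<epsilon>1" "\<epsilon> \<le> \<epsilon>2/2" "\<epsilon> \<le> \<eta>/3"
    using \<epsilon>1 \<epsilon>2 \<eta>3 by (auto simp: \<epsilon>_def)
  have "\<exists>Q>0. \<forall>Q'>0. Q dvd Q' \<longrightarrow>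
      eventually (\<lambda>N. nrm (avg N (\<lambda>n. U (poly_path (Suc D) w (Q' * int n)) u)) \<le> \<eta>) sequentially"
    if u: "nrm u \<le> 1" and sm: "small \<epsilon> (zspan (Suc D) w) u" for w u
  proof -
    let ?v = "w (Suc D)"
    let ?L = "range (\<lambda>j. j *s ?v)"
    obtain k :: int and A where k: "k > 0" and A: "A \<in> ops ((*s) k ` ?L)"
      and fixd: "\<And>v. v \<in> ?L \<Longrightarrow> nrm (U (k *s v) (A u) - A u) \<le> \<epsilon>"
      and smA: "small \<epsilon> ?L (u - A u)"
    proof (rule almost_projection[of ?L u \<epsilon>])
      show "x + y \<in> ?L" if "x \<in> ?L" "y \<in> ?L" for x y
        using that by (auto simp flip: vector_sadd_rdistrib)
      show "c *s x \<in> ?L" if "x \<in> ?L" for x c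
        using that by (auto simp: vector_smult_assoc)
    qed (use u \<epsilon> in auto)
    have fixd': "nrm (U ((k * j) *s ?v) (A u) - A u) \<le> \<epsilon>" for j
      using fixd[of "j *s ?v"] by (simp add: vector_smult_assoc)
    have "small \<epsilon>2 (zspan D w) (A u)"
      unfolding small_def
    proof (intro allI impI)
      fix q :: int assume q: "q \<noteq> 0"
      have "k * q \<noteq> 0" using q k by simp
      then obtain B where B: "B \<in> ops ((*s) (k * q) ` zspan (Suc D) w)" "nrm (B u) \<le> \<epsilon>"
        using sm unfolding small_def by blast
      have "\<exists>B'\<in>ops ((*s) (k * q) ` zspan D w). nrm (B (A u) - B' (A u)) \<le> \<epsilon>"
        using B(1)
      proof (rule ops_project)
        fix x assume "x \<in> (*s) (k * q) ` zspan (Suc D) w"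
        then obtain y j where y: "y \<in> zspan D w" "x = (k * q) *s (y + j *s ?v)"
          by (auto elim!: zspan_Suc_E)
        have "x = (k * q) *s y + (k * (q * j)) *s ?v"
          by (simp add: y(2) vector_add_ldistrib vector_smult_assoc mult.assoc)
        then have "U x (A u) - U ((k * q) *s y) (A u) = U ((k * q) *s y) (U ((k * (q * j)) *s ?v) (A u) - A u)"
          by (simp add: U_plus U_diff)
        then have "nrm (U x (A u) - U ((k * q) *s y) (A u)) \<le> \<epsilon>"
          using fixd'[of "q * j"] by simp
        then show "\<exists>a\<in>(*s) (k * q) ` zspan D w. nrm (U x (A u) - U a (A u)) \<le> \<epsilon>"
          using y(1) by blast
      qed
      then obtain B' where B': "B' \<in> ops ((*s) (k * q) ` zspan D w)" "nrm (B (A u) - B' (A u)) \<le> \<epsilon>"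
        by blast
      have "nrm (B (A u)) \<le> \<epsilon>"
        using ops_comm[OF B(1) A, of u] ops_nrm[OF A, of "B u"] B(2) by simp
      then have "nrm (B' (A u)) \<le> \<epsilon>2"
        using B'(2) \<epsilon>(3) nrm_le_diff[of "B' (A u)" "B (A u)"] by (simp add: nrm_minus_commute)
      moreover have "(*s) (k * q) ` zspan D w \<subseteq> (*s) q ` zspan D w"
      proof
        fix x assume "x \<in> (*s) (k * q) ` zspan D w"
        then obtain a where "x = (k * q) *s (\<Sum>m=1..D. a m *s w m)" by (auto simp: zspan_def)
        then have "x = q *s (\<Sum>m=1..D. (k * a m) *s w m)"
          by (simp add: vector_smult_sum_right vector_smult_assoc algebra_simps)
        then show "x \<in> (*s) q ` zspan D w" by (auto simp: zspan_def)
      qed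
      ultimately show "\<exists>A'\<in>ops ((*s) q ` zspan D w). nrm (A' (A u)) \<le> \<epsilon>2"
        using ops_mono[OF B'(1)] by blast
    qed
    moreover have "nrm (A u) \<le> 1" using ops_nrm[OF A, of u] u by simp
    ultimately obtain Q where Q: "Q > 0" and QQ: "\<And>Q'. Q' > 0 \<Longrightarrow> Q dvd Q' \<Longrightarrow>
      eventually (\<lambda>N. nrm (avg N (\<lambda>n. U (poly_path D w (Q' * int n)) (A u))) \<le> \<eta>/3) sequentially"
      using IH[of "A u" w] by blast
    \<comment> \<open>\<open>Q\<close> serves the path of lower degree; the extra factor
      \<open>k\<close> makes the top term a multiple of \<open>k *s ?v\<close> at every
      time.\<close>
    have "eventually (\<lambda>N. nrm (avg N (\<lambda>n. U (poly_path (Suc D) w (Q' * int n)) u)) \<le> \<eta>) sequentially"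
      if Q': "Q' > 0" "Q * k dvd Q'" for Q'
    proof -
      \<comment> \<open>Dilating time by \<open>Q'\<close> rescales the coefficients, and the top
        one remains a non-zero multiple of \<open>?v\<close>.\<close>
      have "eventually (\<lambda>N. nrm (avg N (\<lambda>n. U (poly_path (Suc D) (\<lambda>m. Q' ^ m *s w m) (int n)) (u - A u))) \<le> \<eta>/3) sequentially"
      proof (rule top)
        show "nrm (u - A u) \<le> 2" using nrm_triangle_sub[of u "A u"] ops_nrm[OF A, of u] u by simp
        show "small \<epsilon>1 ?L (u - A u)"
          using smA \<epsilon>(2) unfolding small_def by (meson order_trans)
      qed (use Q' in auto)
      moreover have "poly_path (Suc D) (\<lambda>m. Q' ^ m *s w m) x = poly_path (Suc D) w (Q' * x)" for x
        by (simp add: poly_path_def vector_smult_assoc power_mult_distrib mult.commute)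
      ultimately have ev1: "eventually (\<lambda>N. nrm (avg N (\<lambda>n. U (poly_path (Suc D) w (Q' * int n)) (u - A u))) \<le> \<eta>/3) sequentially"
        by simp
      have ev2: "eventually (\<lambda>N. nrm (avg N (\<lambda>n. U (poly_path D w (Q' * int n)) (A u))) \<le> \<eta>/3) sequentially"
        using Q' by (intro QQ) (auto dest: dvd_mult_left)
      show ?thesis using ev1 ev2
      proof eventually_elim
        case (elim N)
        let ?z = "\<lambda>D u n. U (poly_path D w (Q' * int n)) u"
        have "nrm (?z (Suc D) (A u) n - ?z D (A u) n) \<le> \<eta>/3" for n
        proof -
          obtain l where l: "Q' = Q * k * l" using Q'(2) by blast
          have "(Q' * int n) ^ Suc D = k * (Q * l * int n * (Q' * int n) ^ D)"
            by (simp add: l mult_ac)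
          then have "poly_path (Suc D) w (Q' * int n) = poly_path D w (Q' * int n) + (k * (Q * l * int n * (Q' * int n) ^ D)) *s ?v"
            by (simp add: poly_path_def del: power_Suc)
          then have "?z (Suc D) (A u) n - ?z D (A u) n =
              U (poly_path D w (Q' * int n)) (U ((k * (Q * l * int n * (Q' * int n) ^ D)) *s ?v) (A u) - A u)"
            by (simp only: U_plus U_diff)
          then show ?thesis
            using fixd'[of "Q * l * int n * (Q' * int n) ^ D"] \<epsilon>(4) by (simp only: nrm_U)
        qed
        then have "nrm (avg N (\<lambda>n. ?z (Suc D) (A u) n - ?z D (A u) n)) \<le> \<eta>/3"
          using \<eta>3 by (intro nrm_avg_le) auto
        then have "nrm (avg N (?z (Suc D) (A u))) \<le> 2 * \<eta>/3"
          using elim(2) nrm_le_diff[of "avg N (?z (Suc D) (A u))" "avg N (?z D (A u))"]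
          unfolding avg_diff by linarith
        moreover have eq: "avg N (?z (Suc D) u) = avg N (?z (Suc D) (u - A u)) + avg N (?z (Suc D) (A u))"
          by (simp add: U_diff flip: avg_add)
        ultimately show ?case
          unfolding eq using nrm_triangle[of "avg N (?z (Suc D) (u - A u))" "avg N (?z (Suc D) (A u))"] elim(1) by linarith
      qed
    qed
    moreover have "Q * k > 0" using Q k by simp
    ultimately show ?thesis by blast
  qed
  then show ?case using \<epsilon>(1) by blast
qed

text \<open>A path with values in the multiples of \<open>k\<close> barely moves \<open>g\<close>,
  and its averages nearly annihilate \<open>u - g\<close> by \<open>path_avg_small\<close>. The
  threshold \<open>\<epsilon>\<close> is fixed before the path and \<open>k\<close>, so it serves
  all determinants.\<close>

lemma level_averages:
  assumes e: "0 < e"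
  obtains \<epsilon> where "\<epsilon> > 0" "\<And>u g w k. nrm (u - g) \<le> 1 \<Longrightarrow> k \<noteq> 0 \<Longrightarrow> small \<epsilon> UNIV (u - g) \<Longrightarrow>
    (\<And>v. nrm (U (k *s v) g - g) \<le> e) \<Longrightarrow> zspan D w = UNIV \<Longrightarrow>
    \<exists>A\<in>ops (range (\<lambda>x. k *s poly_path D w x)). nrm (A u - g) \<le> 2 * e"
proof -
  from path_avg_small[OF e, of D] obtain \<epsilon> where \<epsilon>: "\<epsilon> > 0" and
    "\<forall>w u. nrm u \<le> 1 \<longrightarrow> small \<epsilon> (zspan D w) u \<longrightarrow>
    (\<exists>Q>0. \<forall>Q'>0. Q dvd Q' \<longrightarrow>
      eventually (\<lambda>N. nrm (avg N (\<lambda>n. U (poly_path D w (Q' * int n)) u)) \<le> e) sequentially)"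
    by (elim exE conjE) (rule that)
  note avgs = this(2)[rule_format]
  have "\<exists>A\<in>ops (range (\<lambda>x. k *s poly_path D w x)). nrm (A u - g) \<le> 2 * e"
    if nu: "nrm (u - g) \<le> 1" and k: "k \<noteq> 0" and sm: "small \<epsilon> UNIV (u - g)"
      and fixd: "\<And>v. nrm (U (k *s v) g - g) \<le> e" and span: "zspan D w = UNIV" for u g w k
  proof -
    define w' where "w' m = k *s w m" for m
    have poly_path: "poly_path D w' x = k *s poly_path D w x" for x
      by (simp add: poly_path_def w'_def vector_smult_sum_right vector_smult_assoc mult.commute)
    have zs: "zspan D w' = (*s) k ` UNIV"
      unfolding span[symmetric] by (simp add: zspan_def w'_def image_image vector_smult_sum_right
          vector_smult_assoc mult.commute)
    have "small \<epsilon> (zspan D w') (u - g)"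
      unfolding small_def
    proof (intro allI impI)
      fix q :: int assume "q \<noteq> 0"
      then have "q * k \<noteq> 0" using k by simp
      moreover have "(*s) q ` zspan D w' = (*s) (q * k) ` UNIV"
        by (simp add: zs image_image vector_smult_assoc)
      ultimately show "\<exists>A\<in>ops ((*s) q ` zspan D w'). nrm (A (u - g)) \<le> \<epsilon>"
        using sm unfolding small_def by simp
    qed
    then obtain Q where Q: "Q > 0"
      "eventually (\<lambda>N. nrm (avg N (\<lambda>n. U (poly_path D w' (Q * int n)) (u - g))) \<le> e) sequentially"
      using avgs[OF nu] by (metis dvd_refl)
    obtain N where N: "N > 0" "nrm (avg N (\<lambda>n. U (poly_path D w' (Q * int n)) (u - g))) \<le> e"
      using eventually_happens[OF eventually_conj[OF eventually_gt_at_top[of 0] Q(2)]] by auto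
    obtain A where A: "A \<in> ops (range (\<lambda>n. poly_path D w' (Q * int n)))"
      "\<And>y. A y = avg N (\<lambda>n. U (poly_path D w' (Q * int n)) y)"
      using avg_in_ops[OF N(1), of "\<lambda>n. poly_path D w' (Q * int n)"] by blast
    have "A \<in> ops (range (\<lambda>x. k *s poly_path D w x))"
      using A(1) by (rule ops_mono) (auto simp: poly_path)
    moreover have "nrm (A u - g) \<le> 2 * e"
    proof -
      have "nrm (A g - g) \<le> e"
        using A(1) by (rule ops_almost_fixed) (auto simp: poly_path fixd)
      moreover have "nrm (A u - A g) \<le> e" using N(2) by (simp add: A(2)[of "u - g"] flip: ops_diff[OF A(1)])
      ultimately show ?thesis using nrm_diff_triangle[of "A u" g "A g"] by linarith
    qed
    ultimately show ?thesis by blast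
  qed
  with \<epsilon> that show thesis by blast
qed

text \<open>By isometry, translating \<open>u\<close> costs no more than translating
  \<open>h\<close>, whose movement is controlled.\<close>

lemma ops_ip_almost_fixed:
  assumes "A \<in> ops H" "\<And>v. v \<in> H \<Longrightarrow> nrm (U v h - h) \<le> e"
  shows "\<bar>ip (A u) h - ip u h\<bar> \<le> nrm u * e"
  using assms
proof (induction rule: ops.induct)
  case (base v)
  have "ip (U v u) h - ip u h = ip (U v u) (h - U v h)"
    by (simp add: ip_diff_right ip_U)
  then have "\<bar>ip (U v u) h - ip u h\<bar> \<le> nrm u * nrm (h - U v h)"
    using ip_le_nrm[of "U v u" "h - U v h"] by simp
  also have "\<dots> \<le> nrm u * e"
    using base by (intro mult_left_mono) (auto simp: nrm_minus_commute)
  finally show ?case .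
next
  case (comb A B t)
  have "ip (t *\<^sub>R A u + (1 - t) *\<^sub>R B u) h - ip u h = t * (ip (A u) h - ip u h) + (1 - t) * (ip (B u) h - ip u h)"
    by (simp add: ip_simps algebra_simps)
  also have "\<bar>\<dots>\<bar> \<le> t * \<bar>ip (A u) h - ip u h\<bar> + (1 - t) * \<bar>ip (B u) h - ip u h\<bar>"
    using comb.hyps by (intro order_trans[OF abs_triangle_ineq]) (simp add: abs_mult)
  also have "\<dots> \<le> t * (nrm u * e) + (1 - t) * (nrm u * e)"
    using comb by (intro add_mono mult_left_mono) auto
  finally show ?case by (simp add: algebra_simps)
qed

end

section \<open>Polynomial paths of constant determinant\<close>

text \<open>The larger exponent is determined, since a sum of two powers of 3 is less than three
  times the larger one.\<close>

lemma power3_sum_inj: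
  fixes a b c d :: nat
  assumes "3 ^ a + 3 ^ b = (3 ^ c + 3 ^ d :: nat)"
  shows "(a = c \<and> b = d) \<or> (a = d \<and> b = c)"
proof -
  have sorted: "b = d \<and> a = c" if "a \<le> b" "c \<le> d" "3 ^ a + 3 ^ b = (3 ^ c + 3 ^ d :: nat)" for a b c d :: nat
  proof -
    have bound: "\<not> b < d" if "a \<le> b" "3 ^ a + 3 ^ b = (3 ^ c + 3 ^ d :: nat)" for a b c d :: nat
    proof
      assume "b < d"
      then have "3 ^ Suc b \<le> (3 ^ d :: nat)" by (intro power_increasing) auto
      moreover have "3 ^ a \<le> (3 ^ b :: nat)" using that(1) by (intro power_increasing) auto
      moreover have "0 < (3 ^ b :: nat)" by simp
      ultimately show False using that(2) by simp
    qed
    have "b = d" using bound[of a b c d] bound[of c d a b] that by auto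
    then show ?thesis using that by auto
  qed
  show ?thesis
    using sorted[of a b c d] sorted[of b a c d] sorted[of a b d c] sorted[of b a d c] assms
    by (smt (verit) add.commute nat_le_linear)
qed

text \<open>Each induction step adds a multiple of row \<open>a\<close> to another row; as
  \<open>a\<close> is outside \<open>F\<close>, row \<open>a\<close> remains a unit vector.\<close>

lemma det_shear_column:
  fixes y :: "'n::finite \<Rightarrow> 'a::comm_ring_1"
  assumes "finite F" "a \<notin> F"
  shows "det (\<chi> i k. if k = a \<and> i \<in> F then y i else if i = k then 1 else 0 :: 'a^'n^'n) = 1"
  using assms
proof (induction F)
  case empty
  have "(\<chi> i k. if k = a \<and> i \<in> {} then y i else if i = k then 1 else 0 :: 'a^'n^'n) = mat 1"
    by (simp add: mat_def)
  then show ?case by simp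
next
  case (insert j F)
  let ?Y = "\<lambda>F. (\<chi> i k. if k = a \<and> i \<in> F then y i else if i = k then 1 else 0 :: 'a^'n^'n)"
  have "?Y (insert j F) = (\<chi> k. if k = j then row j (?Y F) + y j *s row a (?Y F) else row k (?Y F))"
    using insert by (auto simp: vec_eq_iff row_def)
  then show ?case using det_row_operation[of j a "?Y F" "y j"] insert by auto
qed

text \<open>The matrix is \<open>X M X\<^sup>T\<close> with \<open>X\<close> unimodular and \<open>M\<close> diagonal of determinant \<open>t\<close>.\<close>

lemma det_square_plus_diagonal:
  fixes p q :: "'n::finite \<Rightarrow> int" and z t :: int
  assumes ab: "a \<noteq> b" and pa: "p a = 1 + z * p b"
    and q: "\<And>i. q i = (if i = b then 1 else if i = a then z else 0)"
  shows "det (\<chi> i j. p i * p j + t * (q i * q j) + of_bool (i = j \<and> i \<noteq> a \<and> i \<noteq> b) :: int^'n^'n) = t"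
proof -
  \<comment> \<open>\<open>X\<close> arises from the shear \<open>Y\<close> by adding
    \<open>z\<close> times row \<open>b\<close> to row \<open>a\<close>: this turns the entries 1
    and 0 of row \<open>a\<close> in columns \<open>a\<close> and \<open>b\<close> into
    \<open>1 + z * p b\<close> and \<open>z\<close>, which are \<open>p a\<close> and
    \<open>q a\<close>.\<close>
  define Y :: "int^'n^'n" where "Y = (\<chi> i k. if k = a \<and> i \<in> - {a} then p i else if i = k then 1 else 0)"
  define X :: "int^'n^'n" where "X = (\<chi> i k. if k = a then p i else if k = b then q i else if i = k then 1 else 0)"
  define d where "d k = (if k = b then t else 1)" for k
  define M :: "int^'n^'n" where "M = (\<chi> k l. if k = l then d k else 0)"
  have "X = (\<chi> k. if k = a then row a Y + z *s row b Y else row k Y)"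
    using ab pa by (auto simp: X_def Y_def vec_eq_iff row_def q)
  then have "det X = det Y" using det_row_operation[OF ab, of Y z] by simp
  also have "\<dots> = 1" unfolding Y_def by (rule det_shear_column) auto
  finally have X: "det X = 1" .
  have M: "det M = t"
    by (subst det_diagonal) (auto simp: M_def d_def prod.If_cases)
  have XM: "(X ** M) $ i $ k = X $ i $ k * d k" for i k
    by (simp add: matrix_matrix_mult_def M_def if_distrib[of "(*) _"] cong: if_cong)
  have "(\<chi> i j. p i * p j + t * (q i * q j) + of_bool (i = j \<and> i \<noteq> a \<and> i \<noteq> b)) = X ** M ** transpose X"
  proof -
    have "p i * p j + t * (q i * q j) + of_bool (i = j \<and> i \<noteq> a \<and> i \<noteq> b) =
        (\<Sum>k\<in>UNIV. X $ i $ k * d k * X $ j $ k)" for i j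
    proof -
      have U: "UNIV = insert a (insert b (- {a, b}))" by auto
      have "(\<Sum>k\<in>UNIV. X $ i $ k * d k * X $ j $ k) =
          p i * p j + (q i * t * q j + (\<Sum>k\<in>- {a, b}. X $ i $ k * d k * X $ j $ k))"
        unfolding U using ab by (simp add: X_def d_def)
      also have "(\<Sum>k\<in>- {a, b}. X $ i $ k * d k * X $ j $ k) =
          (\<Sum>k\<in>- {a, b}. if k = i then of_bool (i = j) else 0)"
        by (rule sum.cong) (auto simp: X_def d_def)
      also have "\<dots> = of_bool (i = j \<and> i \<noteq> a \<and> i \<noteq> b)"
        by (simp add: sum.delta)
      finally show ?thesis by (simp add: algebra_simps)
    qed
    then show ?thesis
      by (simp add: vec_eq_iff matrix_matrix_mult_def[of "X ** M"] transpose_def XM)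
  qed
  then show ?thesis by (simp add: det_mul X M)
qed

text \<open>Instance of \<open>det_square_plus_diagonal\<close> with \<open>z = x ^ e\<close> and
  \<open>p i = x ^ c i\<close>, plus 1 at \<open>i = a\<close>; the relation
  \<open>c a = e + c b\<close> gives the required \<open>p a = 1 + z * p b\<close>. The parameter
  \<open>t\<close> enters the coefficients but not the exponents, so the degree does not depend on
  it.\<close>

lemma det_level_path:
  assumes "CARD('n::finite) \<ge> 2"
  obtains D where "\<And>t. \<exists>V :: nat \<Rightarrow> int^'n^'n. (\<forall>m. V m \<in> Sym) \<and>
     (\<forall>x. det (\<chi> i j. \<Sum>m\<le>D. x ^ m * V m $ i $ j) = t) \<and>
     (\<forall>A\<in>Sym. \<exists>c. \<forall>i j. A $ i $ j = (\<Sum>m=1..D. c m * V m $ i $ j))"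
proof -
  obtain idx :: "'n \<Rightarrow> nat" where idx: "inj idx"
    using finite_imp_inj_to_nat_seg[of "UNIV :: 'n set"] by auto
  obtain a b :: 'n where "idx b < idx a"
  proof -
    obtain a b :: 'n where "a \<noteq> b"
      using assms card_le_Suc0_iff_eq[of "UNIV :: 'n set"] by fastforce
    then show thesis using that[of a b] that[of b a] idx
      by (metis injD linorder_neqE_nat)
  qed
  then have ab: "a \<noteq> b" and fab: "(3::nat) ^ idx b < 3 ^ idx a" by auto
  \<comment> \<open>The exponents \<open>c i + c j\<close> are 2 modulo 3, hence differ from all other exponents of the path, and
    determine \<open>{i, j}\<close>; so the coefficients with these exponents are the elementary symmetric matrices.\<close>
  define c :: "'n \<Rightarrow> nat" where "c i = 1 + 3 * 3 ^ idx i" for i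
  define e where "e = 3 * (3 ^ idx a - 3 ^ idx b :: nat)"
  have ca: "c a = e + c b" using fab unfolding c_def e_def by linarith
  have c0: "c i > 0" for i by (simp add: c_def)
  have cinj: "(i = k \<and> j = l) \<or> (i = l \<and> j = k)" if "c i + c j = c k + c l" for i j k l
    using power3_sum_inj[of "idx i" "idx j" "idx k" "idx l"] that idx
    by (auto simp: c_def dest: injD)
  have mod3: "c k + c l \<noteq> c i" "c k + c l \<noteq> 0" "c k + c l \<noteq> e" "c k + c l \<noteq> 2 * e" for i k l
  proof -
    have m: "c i mod 3 = 1" "(c k + c l) mod 3 = 2" "e mod 3 = 0" "(2 * e) mod 3 = 0"
      unfolding c_def e_def by presburger+
    show "c k + c l \<noteq> c i" using m(1,2) by (metis numeral_eq_one_iff semiring_norm(85))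
    show "c k + c l \<noteq> 0" using c0[of k] by simp
    show "c k + c l \<noteq> e" using m(2,3) by (metis zero_neq_numeral)
    show "c k + c l \<noteq> 2 * e" using m(2,4) by (metis zero_neq_numeral)
  qed
  define D where "D = 2 * Max (range c)"
  have cle: "c i \<le> Max (range c)" for i by simp
  have D: "c i + c j \<le> D" "c i \<le> D" "e \<le> D" "2 * e \<le> D" for i j
    using cle[of i] cle[of j] cle[of a] ca unfolding D_def by linarith+
  have "\<exists>V :: nat \<Rightarrow> int^'n^'n. (\<forall>m. V m \<in> Sym) \<and>
     (\<forall>x. det (\<chi> i j. \<Sum>m\<le>D. x ^ m * V m $ i $ j) = t) \<and>
     (\<forall>A\<in>Sym. \<exists>c. \<forall>i j. A $ i $ j = (\<Sum>m=1..D. c m * V m $ i $ j))" for t :: int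
  proof -
    \<comment> \<open>The coefficient of \<open>x ^ m\<close> in
      \<open>p i * p j + t * (q i * q j)\<close> plus the diagonal part, for the \<open>p\<close>
      and \<open>q\<close> introduced below.\<close>
    define V :: "nat \<Rightarrow> int^'n^'n" where "V m = (\<chi> i j. of_bool (m = c i + c j) +
      of_bool (j = a) * of_bool (m = c i) + of_bool (i = a) * of_bool (m = c j) + of_bool (i = a \<and> j = a) * of_bool (m = 0) +
      t * (of_bool (i = b \<and> j = b) * of_bool (m = 0) + of_bool (i = b \<and> j = a \<or> i = a \<and> j = b) * of_bool (m = e) +
        of_bool (i = a \<and> j = a) * of_bool (m = 2 * e)) +
      of_bool (i = j \<and> i \<noteq> a \<and> i \<noteq> b) * of_bool (m = 0))" for m
    have sym: "V m \<in> Sym" for m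
      by (auto simp: Sym_def V_def transpose_def vec_eq_iff add.commute conj_commute disj_commute)
    have pick: "(\<Sum>m\<le>D. x ^ m * (r * of_bool (m = k))) = r * x ^ k" if "k \<le> D" for x r :: int and k
      using that by (simp add: of_bool_def if_distrib[of "(*) _"] mult.commute cong: if_cong)
    have pick1: "(\<Sum>m\<le>D. x ^ m * of_bool (m = k)) = x ^ k" if "k \<le> D" for x :: int and k
      using pick[OF that, of x 1] by simp
    have det: "det (\<chi> i j. \<Sum>m\<le>D. x ^ m * V m $ i $ j) = t" for x
    proof -
      define p where "p i = x ^ c i + of_bool (i = a)" for i
      define q where "q i = (if i = b then 1 else if i = a then x ^ e else 0)" for i
      have 1: "(\<Sum>m\<le>D. x ^ m * V m $ i $ j) =
        x ^ (c i + c j) + of_bool (j = a) * x ^ c i + of_bool (i = a) * x ^ c j + of_bool (i = a \<and> j = a) * x ^ 0 +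
        (t * of_bool (i = b \<and> j = b) * x ^ 0 + t * of_bool (i = b \<and> j = a \<or> i = a \<and> j = b) * x ^ e +
          t * of_bool (i = a \<and> j = a) * x ^ (2 * e)) +
        of_bool (i = j \<and> i \<noteq> a \<and> i \<noteq> b) * x ^ 0" for i j
        unfolding V_def vec_lambda_beta distrib_left sum.distrib mult.assoc[symmetric, of t]
          pick1[OF D(1)] pick[OF D(2)] pick[OF D(3)] pick[OF D(4)] pick[OF le0] ..
      have "(\<Sum>m\<le>D. x ^ m * V m $ i $ j) = p i * p j + t * (q i * q j) + of_bool (i = j \<and> i \<noteq> a \<and> i \<noteq> b)" for i j
        unfolding 1 using ab by (auto simp: p_def q_def power_add algebra_simps mult_2 mult_2_right)
      moreover have "p a = 1 + x ^ e * p b"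
        using ab by (simp add: p_def ca power_add)
      ultimately show ?thesis
        using det_square_plus_diagonal[OF ab, of p "x ^ e" q t] by (simp add: q_def)
    qed
    have "\<exists>s. \<forall>i j. A $ i $ j = (\<Sum>m=1..D. s m * V m $ i $ j)" if A: "A \<in> Sym" for A
    proof -
      have Asym: "A $ i $ j = A $ j $ i" for i j
        using A by (auto simp: Sym_def transpose_def vec_eq_iff)
      \<comment> \<open>By \<open>cinj\<close> the chosen pair is unique up to order, and
        \<open>A\<close> is symmetric, so the choice does not matter.\<close>
      define s where "s m = (if \<exists>k l. m = c k + c l
        then (case (SOME kl. m = c (fst kl) + c (snd kl)) of (k, l) \<Rightarrow> A $ k $ l) else 0)" for m
      have s: "s (c k + c l) = A $ k $ l" for k l
      proof -
        have "c k + c l = c (fst kl) + c (snd kl)" if "kl = (SOME kl. c k + c l = c (fst kl) + c (snd kl))" for kl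
          unfolding that by (rule someI[of "\<lambda>kl. c k + c l = c (fst kl) + c (snd kl)" "(k, l)"]) simp
        then show ?thesis
          unfolding s_def using cinj Asym by (auto split: prod.splits) (metis fst_conv snd_conv)+
      qed
      have "s m * V m $ i $ j = (if m = c i + c j then A $ i $ j else 0)" for m i j
      proof (cases "\<exists>k l. m = c k + c l")
        case True
        then obtain k l where m: "m = c k + c l" by blast
        have "V m $ i $ j = of_bool (m = c i + c j)"
          unfolding V_def using mod3[of k l] by (auto simp: m simp del: add_is_0 add_eq_0_iff_both_eq_0)
        then show ?thesis using s by auto
      qed (auto simp: s_def)
      then have "(\<Sum>m=1..D. s m * V m $ i $ j) = A $ i $ j" for i j
        using D(1)[of i j] c0[of i] by (simp add: sum.delta)
      then show ?thesis by metis
    qed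
    with sym det show ?thesis by blast
  qed
  then show thesis using that by blast
qed

section \<open>Invariant means\<close>

text \<open>Zorn's lemma for the reversed order gives a minimal proper filter below
  \<open>F\<close>; the infimum of a chain stays proper because each of its events already occurs in
  a member. If \<open>P\<close> is compatible with the minimal filter, adding \<open>P\<close>
  changes nothing.\<close>

lemma ex_ultrafilter:
  fixes F :: "'a filter"
  assumes "F \<noteq> bot"
  obtains G where "G \<le> F" "G \<noteq> bot" "\<And>P. eventually P G \<or> eventually (\<lambda>x. \<not> P x) G"
proof -
  let ?A = "{G. G \<noteq> bot \<and> G \<le> F}"
  have "\<exists>m\<in>?A. \<forall>a\<in>?A. a \<le> m \<longrightarrow> a = m"
  proof (rule predicate_Zorn)
    show "partial_order_on ?A (relation_of (\<lambda>x y. y \<le> x) ?A)"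
      by (rule partial_order_on_relation_ofI) auto
    fix C assume C: "C \<in> Chains (relation_of (\<lambda>x y. y \<le> x) ?A)"
    show "\<exists>u\<in>?A. \<forall>a\<in>C. u \<le> a"
    proof (cases "C = {}")
      case True
      then show ?thesis using assms by auto
    next
      case False
      have sub: "C \<subseteq> ?A" and chain: "\<And>x y. x \<in> C \<Longrightarrow> y \<in> C \<Longrightarrow> x \<le> y \<or> y \<le> x"
        using C by (auto simp: Chains_def relation_of_def)
      have "eventually P (Inf C) \<longleftrightarrow> (\<exists>b\<in>C. eventually P b)" for P
      proof (rule eventually_Inf_base[OF False])
        fix F G assume FG: "F \<in> C" "G \<in> C"
        then have "F \<le> G \<or> G \<le> F" by (rule chain)
        then show "\<exists>x\<in>C. x \<le> inf F G"
          using FG by (auto simp: le_inf_iff)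
      qed
      then have "Inf C \<noteq> bot"
        using sub by (auto simp: trivial_limit_def)
      moreover obtain x where "x \<in> C" using False by blast
      then have "Inf C \<le> F" using sub by (blast intro: order_trans Inf_lower)
      ultimately show ?thesis by (intro bexI[of _ "Inf C"]) (auto intro: Inf_lower)
    qed
  qed
  then obtain G where G: "G \<noteq> bot" "G \<le> F" and min: "\<And>H. H \<noteq> bot \<Longrightarrow> H \<le> F \<Longrightarrow> H \<le> G \<Longrightarrow> H = G"
    by auto
  have "eventually P G \<or> eventually (\<lambda>x. \<not> P x) G" for P
  proof (cases "inf G (principal {x. P x}) = bot")
    case True
    then have "eventually (\<lambda>x. False) (inf G (principal {x. P x}))" by simp
    then show ?thesis by (simp add: eventually_inf_principal)
  next
    case False
    then have "inf G (principal {x. P x}) = G"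
      using G(2) by (intro min) (auto intro: le_infI1)
    then have "G \<le> principal {x. P x}" by (metis inf_le2)
    then show ?thesis by (simp add: le_principal)
  qed
  with G that show thesis by blast
qed

text \<open>Compactness of an interval gives a cluster point, and a cluster point of an ultrafilter
  is a limit.\<close>

lemma ultrafilter_bounded_convergent:
  fixes X :: "'a \<Rightarrow> real"
  assumes "G \<noteq> bot" "\<And>P. eventually P G \<or> eventually (\<lambda>x. \<not> P x) G" "bounded (range X)"
  shows "\<exists>l. (X \<longlongrightarrow> l) G"
proof -
  obtain b where b: "\<And>x. \<bar>X x\<bar> \<le> b" using assms(3) by (auto simp: bounded_iff)
  have "eventually (\<lambda>y. y \<in> {-b..b}) (filtermap X G)"
    using b by (simp add: eventually_filtermap abs_le_iff minus_le_iff)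
  moreover have "filtermap X G \<noteq> bot" using assms(1) by (simp add: filtermap_bot_iff)
  ultimately obtain l where l: "inf (nhds l) (filtermap X G) \<noteq> bot"
    using compact_Icc[of "-b" b] unfolding compact_filter by blast
  have "(X \<longlongrightarrow> l) G"
  proof (rule topological_tendstoI)
    fix S assume S: "open S" "l \<in> S"
    show "eventually (\<lambda>x. X x \<in> S) G"
    proof (rule ccontr)
      assume "\<not> eventually (\<lambda>x. X x \<in> S) G"
      then have "eventually (\<lambda>y. y \<notin> S) (filtermap X G)"
        using assms(2)[of "\<lambda>x. X x \<in> S"] by (simp add: eventually_filtermap)
      moreover have "eventually (\<lambda>y. y \<in> S) (nhds l)" using S by (rule eventually_nhds_in_open)
      ultimately have "eventually (\<lambda>y. False) (inf (nhds l) (filtermap X G))"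
        unfolding eventually_inf by (intro exI[of _ "\<lambda>y. y \<in> S"] exI[of _ "\<lambda>y. y \<notin> S"]) auto
      then show False using l by (simp add: trivial_limit_def)
    qed
  qed
  then show ?thesis ..
qed

text \<open>The laws are restricted to bounded functions because \<open>L\<close> is total; on
  unbounded functions its values are arbitrary.\<close>

definition invariant_mean :: "((int^'N::finite \<Rightarrow> real) \<Rightarrow> real) \<Rightarrow> bool" where
  "invariant_mean L \<longleftrightarrow>
    (\<forall>f g. bounded (range f) \<longrightarrow> bounded (range g) \<longrightarrow> L (\<lambda>x. f x + g x) = L f + L g) \<and>
    (\<forall>c f. bounded (range f) \<longrightarrow> L (\<lambda>x. c * f x) = c * L f) \<and>
    (\<forall>f. bounded (range f) \<longrightarrow> (\<forall>x. 0 \<le> f x) \<longrightarrow> 0 \<le> L f) \<and>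
    L (\<lambda>_. 1) = 1 \<and>
    (\<forall>v f. bounded (range f) \<longrightarrow> L (\<lambda>x. f (x + v)) = L f)"

lemma card_Folner_box: "card (Folner_box n :: (int^'N::finite) set) = (2 * n + 1) ^ CARD('N)"
  and finite_Folner_box: "finite (Folner_box n :: (int^'N::finite) set)"
proof -
  have bij: "bij_betw (\<lambda>f. \<chi> i. f i) (PiE UNIV (\<lambda>_. {- int n..int n})) (Folner_box n :: (int^'N) set)"
    by (rule bij_betw_byWitness[where f' = "\<lambda>x i. x $ i"]) (auto simp: Folner_box_def abs_le_iff minus_le_iff PiE_iff)
  show "card (Folner_box n :: (int^'N) set) = (2 * n + 1) ^ CARD('N)"
    using bij_betw_same_card[OF bij] by (simp add: card_PiE nat_add_distrib nat_mult_distrib)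
  show "finite (Folner_box n :: (int^'N) set)"
    using bij_betw_finite[OF bij] by (simp add: finite_PiE)
qed

lemma Folner_box_nonempty: "card (Folner_box n :: (int^'N::finite) set) > 0"
  by (simp add: card_Folner_box)

definition box_avg :: "int^'N::finite \<Rightarrow> nat \<Rightarrow> (int^'N \<Rightarrow> real) \<Rightarrow> real" where
  "box_avg a n f = (\<Sum>x\<in>Folner_box n. f (x + a)) / real (card (Folner_box n :: (int^'N) set))"

lemma box_avg_bound:
  fixes a :: "int^'N::finite"
  assumes "\<And>x. \<bar>f x\<bar> \<le> b"
  shows "\<bar>box_avg a n f\<bar> \<le> b"
proof -
  have "\<bar>\<Sum>x\<in>Folner_box n. f (x + a)\<bar> \<le> (\<Sum>x\<in>Folner_box n. \<bar>f (x + a)\<bar>)"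
    by (rule sum_abs)
  also have "\<dots> \<le> (\<Sum>x\<in>(Folner_box n :: (int^'N) set). b)"
    by (rule sum_mono) (rule assms)
  finally show ?thesis
    using Folner_box_nonempty[of n, where 'N = 'N] by (simp add: box_avg_def field_simps)
qed

text \<open>The two sums differ only on the symmetric difference of a box and its translate. One
  half of it lies between the boxes of radius \<open>n\<close> and \<open>n + c\<close>, and the
  other half has the same cardinality.\<close>

lemma box_avg_shift:
  fixes v a :: "int^'N::finite"
  assumes b: "\<And>x. \<bar>f x\<bar> \<le> b" and c: "\<And>i. \<bar>v $ i\<bar> \<le> int c"
  shows "\<bar>box_avg a n (\<lambda>x. f (x + v)) - box_avg a n f\<bar> \<le>
    2 * b * (((2 * real (n + c) + 1) / (2 * real n + 1)) ^ CARD('N) - 1)"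
proof -
  let ?F = "Folner_box n :: (int^'N) set"
  let ?G = "(\<lambda>x. x + v) ` ?F"
  let ?g = "\<lambda>x. f (x + a)"
  have fin: "finite ?F" "finite ?G" by (auto simp: finite_Folner_box)
  have b0: "0 \<le> b" using b[of 0] by linarith
  have cardG: "card ?G = card ?F" by (rule card_image) simp
  have "?G - ?F \<subseteq> Folner_box (n + c) - ?F"
  proof
    fix y assume y: "y \<in> ?G - ?F"
    then obtain x where x: "x \<in> ?F" "y = x + v" by blast
    have "\<bar>y $ i\<bar> \<le> int (n + c)" for i
      using x c[of i] unfolding Folner_box_def by (auto dest!: spec[of _ i])
    then show "y \<in> Folner_box (n + c) - ?F" using y by (simp add: Folner_box_def)
  qed
  then have "card (?G - ?F) \<le> card (Folner_box (n + c) - ?F)"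
    by (intro card_mono) (auto simp: finite_Folner_box)
  also have "\<dots> = card (Folner_box (n + c) :: (int^'N) set) - card ?F"
    by (intro card_Diff_subset fin) (fastforce simp: Folner_box_def intro: order_trans[of _ "int n"])
  finally have "real (card (?G - ?F)) \<le> (2 * real (n + c) + 1) ^ CARD('N) - (2 * real n + 1) ^ CARD('N)"
  proof -
    assume *: "card (?G - ?F) \<le> card (Folner_box (n + c) :: (int^'N) set) - card ?F"
    have "(2 * n + 1) ^ CARD('N) \<le> (2 * (n + c) + 1) ^ CARD('N)" by (intro power_mono) auto
    with * have "real (card (?G - ?F)) \<le> real ((2 * (n + c) + 1) ^ CARD('N)) - real ((2 * n + 1) ^ CARD('N))"
      unfolding card_Folner_box by linarith
    then show ?thesis by (simp add: algebra_simps)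
  qed
  then have cGF: "real (card (?G - ?F)) / real (card ?F) \<le> ((2 * real (n + c) + 1) / (2 * real n + 1)) ^ CARD('N) - 1"
  proof -
    have "real (card ?F) = (2 * real n + 1) ^ CARD('N)" by (simp add: card_Folner_box add.commute)
    moreover assume "real (card (?G - ?F)) \<le> (2 * real (n + c) + 1) ^ CARD('N) - (2 * real n + 1) ^ CARD('N)"
    moreover have "(2 * real n + 1) ^ CARD('N) > 0" by simp
    ultimately show ?thesis by (simp add: power_divide field_simps)
  qed
  have cFG: "card (?F - ?G) = card (?G - ?F)"
    using card_Int_Diff[OF fin(2), of ?F] card_Int_Diff[OF fin(1), of ?G] cardG by (simp add: Int_commute)
  have "(\<Sum>x\<in>?F. f (x + a + v)) = sum ?g ?G"
    by (subst sum.reindex) (auto simp: algebra_simps)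
  also have "\<dots> = sum ?g (?G - ?F) + sum ?g (?G \<inter> ?F)"
    using sum.Int_Diff[OF fin(2), of ?g ?F] by simp
  finally have 1: "(\<Sum>x\<in>?F. f (x + a + v)) = sum ?g (?G - ?F) + sum ?g (?G \<inter> ?F)" .
  have 2: "sum ?g ?F = sum ?g (?F - ?G) + sum ?g (?G \<inter> ?F)"
    using sum.Int_Diff[OF fin(1), of ?g ?G] by (simp add: Int_commute)
  have bnd: "\<bar>sum ?g S\<bar> \<le> b * real (card S)" for S
  proof -
    have "\<bar>sum ?g S\<bar> \<le> (\<Sum>x\<in>S. \<bar>?g x\<bar>)" by (rule sum_abs)
    also have "\<dots> \<le> (\<Sum>x\<in>S. b)" by (rule sum_mono) (rule b)
    finally show ?thesis by (simp add: mult.commute)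
  qed
  have "\<bar>(\<Sum>x\<in>?F. f (x + a + v)) - sum ?g ?F\<bar> \<le> 2 * b * real (card (?G - ?F))"
    using bnd[of "?G - ?F"] bnd[of "?F - ?G"] unfolding 1 2 cFG by linarith
  then have "\<bar>(\<Sum>x\<in>?F. f (x + a + v)) - sum ?g ?F\<bar> / real (card ?F) \<le> 2 * b * (real (card (?G - ?F)) / real (card ?F))"
    by (simp add: divide_right_mono)
  also have "\<dots> \<le> 2 * b * (((2 * real (n + c) + 1) / (2 * real n + 1)) ^ CARD('N) - 1)"
    using cGF b0 by (intro mult_left_mono) auto
  also have "\<bar>(\<Sum>x\<in>?F. f (x + a + v)) - sum ?g ?F\<bar> / real (card ?F) =
      \<bar>box_avg a n (\<lambda>x. f (x + v)) - box_avg a n f\<bar>"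
    by (simp add: box_avg_def flip: diff_divide_distrib)
  finally show ?thesis .
qed

text \<open>\<open>L\<close> is the limit of box averages along an ultrafilter below
  \<open>F\<close>. The filter \<open>F\<close> is a parameter so that this limit can be confined to
  those \<open>n\<close> for which an average is large.\<close>

lemma ex_invariant_mean:
  fixes a :: "nat \<Rightarrow> int^'N::finite"
  assumes F: "F \<noteq> bot" "F \<le> sequentially"
  obtains L where "invariant_mean L"
    "\<And>f d. bounded (range f) \<Longrightarrow> eventually (\<lambda>n. d \<le> box_avg (a n) n f) F \<Longrightarrow> d \<le> L f"
proof -
  obtain G where G: "G \<le> F" "G \<noteq> bot" "\<And>P. eventually P G \<or> eventually (\<lambda>x. \<not> P x) G"
    using ex_ultrafilter[OF F(1)] by blast
  define L where "L f = Lim G (\<lambda>n. box_avg (a n) n f)" for f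
  have lim: "((\<lambda>n. box_avg (a n) n f) \<longlongrightarrow> L f) G" if f: "bounded (range f)" for f
  proof -
    obtain b where "\<And>x. \<bar>f x\<bar> \<le> b" using f by (auto simp: bounded_iff)
    then have "bounded (range (\<lambda>n. box_avg (a n) n f))"
      using box_avg_bound[of f b] by (auto simp: bounded_iff intro!: exI[of _ b])
    then obtain l where "((\<lambda>n. box_avg (a n) n f) \<longlongrightarrow> l) G"
      using ultrafilter_bounded_convergent[OF G(2,3)] by blast
    then show ?thesis unfolding L_def using tendsto_Lim[OF G(2)] by blast
  qed
  have bnd_comp: "bounded (range (\<lambda>x. f (x + v)))" if "bounded (range f)" for f :: "int^'N \<Rightarrow> real" and v
    using that by (rule bounded_subset) auto
  have bnd_add: "bounded (range (\<lambda>x. f x + g x))" if "bounded (range f)" "bounded (range g)" for f g :: "int^'N \<Rightarrow> real"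
    using that by (rule bounded_plus_comp)
  have bnd_mult: "bounded (range (\<lambda>x. c * f x))" if "bounded (range f)" for f :: "int^'N \<Rightarrow> real" and c
    using bounded_scaling[OF that, of c] by (simp add: image_image)
  have "invariant_mean L"
    unfolding invariant_mean_def
  proof (intro conjI allI impI)
    fix f g :: "int^'N \<Rightarrow> real" assume f: "bounded (range f)" and g: "bounded (range g)"
    have "((\<lambda>n. box_avg (a n) n f + box_avg (a n) n g) \<longlongrightarrow> L f + L g) G"
      using f g by (intro tendsto_add lim)
    moreover have "box_avg (a n) n f + box_avg (a n) n g = box_avg (a n) n (\<lambda>x. f x + g x)" for n
      by (simp add: box_avg_def sum.distrib add_divide_distrib)
    ultimately show "L (\<lambda>x. f x + g x) = L f + L g"
      using lim[OF bnd_add[OF f g]] tendsto_unique[OF G(2)] by auto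
  next
    fix c and f :: "int^'N \<Rightarrow> real" assume f: "bounded (range f)"
    have "((\<lambda>n. c * box_avg (a n) n f) \<longlongrightarrow> c * L f) G"
      using f by (intro tendsto_mult_left lim)
    moreover have "c * box_avg (a n) n f = box_avg (a n) n (\<lambda>x. c * f x)" for n
      by (simp add: box_avg_def sum_distrib_left)
    ultimately have "((\<lambda>n. box_avg (a n) n (\<lambda>x. c * f x)) \<longlongrightarrow> c * L f) G" by simp
    then show "L (\<lambda>x. c * f x) = c * L f"
      by (rule tendsto_unique[OF G(2) lim[OF bnd_mult[OF f]]])
  next
    fix f :: "int^'N \<Rightarrow> real" assume f: "bounded (range f)" "\<forall>x. 0 \<le> f x"
    then show "0 \<le> L f"
      by (intro tendsto_lowerbound[OF lim[OF f(1)] _ G(2)] always_eventually)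
        (auto simp: box_avg_def intro!: divide_nonneg_nonneg sum_nonneg)
  next
    have "box_avg (a n) n (\<lambda>_. 1) = 1" for n
      using Folner_box_nonempty[of n, where 'N = 'N] by (simp add: box_avg_def)
    then show "L (\<lambda>_. 1) = 1"
      using lim[of "\<lambda>_. 1"] tendsto_unique[OF G(2) _ tendsto_const] by simp
  next
    fix v :: "int^'N" and f :: "int^'N \<Rightarrow> real" assume f: "bounded (range f)"
    obtain b where b: "\<And>x. \<bar>f x\<bar> \<le> b" using f by (auto simp: bounded_iff)
    define c where "c = nat (\<Sum>i\<in>UNIV. \<bar>v $ i\<bar>)"
    have c: "\<bar>v $ i\<bar> \<le> int c" for i
      unfolding c_def by (simp add: sum_nonneg) (rule member_le_sum, auto)
    have "(\<lambda>n. 1 + 2 * real c / (2 * real n + 1)) \<longlonglongrightarrow> 1 + 0"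
      by (intro tendsto_intros tendsto_divide_0[OF tendsto_const] filterlim_at_top_imp_at_infinity)
        (rule filterlim_at_top_mono[OF filterlim_real_sequentially], auto)
    moreover have "1 + 2 * real c / (2 * real n + 1) = (2 * real (n + c) + 1) / (2 * real n + 1)" for n
      by (simp add: field_simps)
    ultimately have "(\<lambda>n. (2 * real (n + c) + 1) / (2 * real n + 1)) \<longlonglongrightarrow> 1" by simp
    then have "(\<lambda>n. 2 * b * (((2 * real (n + c) + 1) / (2 * real n + 1)) ^ CARD('N) - 1)) \<longlonglongrightarrow> 2 * b * (1 ^ CARD('N) - 1)"
      by (intro tendsto_intros)
    then have 0: "((\<lambda>n. 2 * b * (((2 * real (n + c) + 1) / (2 * real n + 1)) ^ CARD('N) - 1)) \<longlongrightarrow> 0) G"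
      using G(1) F(2) by (auto intro: tendsto_mono order_trans)
    have "((\<lambda>n. box_avg (a n) n (\<lambda>x. f (x + v)) - box_avg (a n) n f) \<longlongrightarrow> 0) G"
      by (rule Lim_null_comparison[OF always_eventually 0]) (simp only: real_norm_def, intro allI box_avg_shift[OF b c])
    moreover have "((\<lambda>n. box_avg (a n) n (\<lambda>x. f (x + v)) - box_avg (a n) n f) \<longlongrightarrow> L (\<lambda>x. f (x + v)) - L f) G"
      by (intro tendsto_diff lim f bnd_comp)
    ultimately show "L (\<lambda>x. f (x + v)) = L f"
      using tendsto_unique[OF G(2)] by fastforce
  qed
  moreover have "d \<le> L f" if "bounded (range f)" "eventually (\<lambda>n. d \<le> box_avg (a n) n f) F" for f d
    using that G(1) by (intro tendsto_lowerbound[OF lim _ G(2)]) (auto intro: filter_leD)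
  ultimately show thesis using that by blast
qed

lemma positive_density_mean:
  fixes E :: "(int^'N::finite) set"
  assumes "upper_Banach_density E > 0"
  obtains L where "invariant_mean L" "L (indicator E) > 0"
proof -
  define r where "r a n = real (card (E \<inter> (\<lambda>x. x + a) ` Folner_box n)) / real (card (Folner_box n :: (int^'N) set))" for a n
  obtain a :: "nat \<Rightarrow> int^'N" where "0 < limsup (\<lambda>n. ereal (r (a n) n))"
    using assms unfolding upper_Banach_density_def r_def less_SUP_iff by blast
  then obtain d where d: "0 < ereal d" "ereal d < limsup (\<lambda>n. ereal (r (a n) n))"
    using ereal_dense2 by blast
  \<comment> \<open>Restricting to the \<open>n\<close> with density at least \<open>d\<close>
    leaves a proper filter because the upper limit exceeds \<open>d\<close>.\<close>
  let ?F = "inf sequentially (principal {n. d \<le> r (a n) n})"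
  have "?F \<noteq> bot"
  proof
    assume "?F = bot"
    then have "eventually (\<lambda>n. r (a n) n < d) sequentially"
      by (simp add: trivial_limit_def eventually_inf_principal not_le)
    then have "limsup (\<lambda>n. ereal (r (a n) n)) \<le> ereal d"
      by (intro Limsup_bounded) (auto elim: eventually_mono)
    with d show False by simp
  qed
  moreover have "?F \<le> sequentially" by simp
  ultimately obtain L where L: "invariant_mean L"
    "\<And>f d. bounded (range f) \<Longrightarrow> eventually (\<lambda>n. d \<le> box_avg (a n) n f) ?F \<Longrightarrow> d \<le> L f"
    using ex_invariant_mean[of ?F a] by blast
  have "box_avg b n (indicator E) = r b n" for b n
  proof -
    have "(\<Sum>x\<in>Folner_box n. indicator E (x + b)) = (\<Sum>x\<in>(\<lambda>x. x + b) ` Folner_box n. indicator E x :: real)"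
      by (subst sum.reindex) auto
    also have "\<dots> = (\<Sum>x\<in>(\<lambda>x. x + b) ` Folner_box n. if x \<in> E then 1 else 0)"
      by (rule sum.cong) (auto simp: indicator_def)
    also have "\<dots> = real (card (E \<inter> (\<lambda>x. x + b) ` Folner_box n))"
      by (simp add: sum.If_cases finite_Folner_box Int_commute)
    finally show ?thesis by (simp add: box_avg_def r_def)
  qed
  then have "d \<le> L (indicator E)"
    by (intro L(2)) (auto simp: eventually_inf_principal bounded_iff indicator_def intro!: exI[of _ 1])
  with d L(1) that show thesis by auto
qed

text \<open>The lattice is discrete, so continuity is automatic, and the type of bounded continuous
  functions serves as the vector space of all bounded functions.\<close>

lemma bounded_imp_bcontfun:
  fixes f :: "int^'N::finite \<Rightarrow> real"
  assumes "bounded (range f)"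
  shows "f \<in> bcontfun"
proof -
  have "open S" for S :: "(int^'N) set"
    unfolding open_vec_def
  proof
    fix x assume "x \<in> S"
    then show "\<exists>A. (\<forall>i. open (A i) \<and> x $ i \<in> A i) \<and> (\<forall>y. (\<forall>i. y $ i \<in> A i) \<longrightarrow> y \<in> S)"
      by (intro exI[of _ "\<lambda>i. {x $ i}"]) (auto simp: open_discrete simp flip: vec_eq_iff)
  qed
  then have "continuous_on UNIV f" by (simp add: continuous_on_open_vimage)
  then show ?thesis using assms by (simp add: bcontfun_def)
qed

definition translate :: "int^'N::finite \<Rightarrow> ((int^'N) \<Rightarrow>\<^sub>C real) \<Rightarrow> ((int^'N) \<Rightarrow>\<^sub>C real)" where
  "translate v F = Bcontfun (\<lambda>x. apply_bcontfun F (x + v))"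

lemma apply_Bcontfun:
  fixes f :: "int^'N::finite \<Rightarrow> real"
  shows "bounded (range f) \<Longrightarrow> apply_bcontfun (Bcontfun f) = f"
  by (simp add: Bcontfun_inverse bounded_imp_bcontfun)

lemma translate_apply [simp]: "apply_bcontfun (translate v F) x = apply_bcontfun F (x + v)"
proof -
  have "bounded (range (\<lambda>x. apply_bcontfun F (x + v)))"
    by (rule bounded_subset[OF bounded_apply_bcontfun[of F]]) auto
  then show ?thesis unfolding translate_def by (simp add: apply_Bcontfun)
qed

lemma bounded_mult_range:
  fixes f g :: "'a \<Rightarrow> real"
  assumes "bounded (range f)" "bounded (range g)"
  shows "bounded (range (\<lambda>x. f x * g x))"
proof -
  obtain a b where "\<And>x. \<bar>f x\<bar> \<le> a" "\<And>x. \<bar>g x\<bar> \<le> b"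
    using assms by (auto simp: bounded_iff)
  then have "\<bar>f x * g x\<bar> \<le> a * b" for x
    unfolding abs_mult by (intro mult_mono) (auto intro: order_trans[OF abs_ge_zero])
  then show ?thesis by (auto simp: bounded_iff)
qed

lemma bounded_prod_range:
  fixes f :: "'i \<Rightarrow> 'a \<Rightarrow> real"
  assumes "\<And>i. bounded (range (f i))"
  shows "bounded (range (\<lambda>x. \<Prod>i\<in>T. f i x))"
proof (induction T rule: infinite_finite_induct)
  case (insert i T)
  then show ?case using bounded_mult_range[OF assms[of i] insert.IH] by simp
qed auto

lemma bounded_sum_range:
  fixes f :: "'i \<Rightarrow> 'a \<Rightarrow> real"
  assumes "\<And>i. bounded (range (f i))"
  shows "bounded (range (\<lambda>x. \<Sum>i\<in>T. f i x))"
proof (induction T rule: infinite_finite_induct)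
  case (insert i T)
  then show ?case using bounded_plus_comp[OF assms[of i] insert.IH] by simp
qed auto

text \<open>Convexity of the power function: its graph lies above the tangent at \<open>c\<close>.
  This is Bernoulli's inequality for \<open>x / c\<close>.\<close>

lemma power_tangent:
  fixes x c :: real
  assumes "0 \<le> x" "0 < c"
  shows "c ^ Suc n + real (Suc n) * c ^ n * (x - c) \<le> x ^ Suc n"
proof -
  have "1 + real (Suc n) * (x / c - 1) \<le> (1 + (x / c - 1)) ^ Suc n"
    by (rule Bernoulli_inequality) (use assms in simp)
  then have "c ^ Suc n * (1 + real (Suc n) * (x / c - 1)) \<le> c ^ Suc n * (x / c) ^ Suc n"
    using assms by (intro mult_left_mono) auto
  moreover have "c ^ Suc n * (1 + real (Suc n) * (x / c - 1)) = c ^ Suc n + real (Suc n) * c ^ n * (x - c)"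
    using assms by (simp add: field_simps)
  moreover have "c ^ Suc n * (x / c) ^ Suc n = x ^ Suc n"
    using assms by (simp add: power_divide)
  ultimately show ?thesis by linarith
qed

section \<open>The semi-inner product given by an invariant mean\<close>

locale bounded_mean =
  fixes L :: "(int^'N::finite \<Rightarrow> real) \<Rightarrow> real"
  assumes invariant: "invariant_mean L"
begin

lemma mean_add: "bounded (range f) \<Longrightarrow> bounded (range g) \<Longrightarrow> L (\<lambda>x. f x + g x) = L f + L g"
  and mean_scale: "bounded (range f) \<Longrightarrow> L (\<lambda>x. c * f x) = c * L f"
  and mean_nonneg: "bounded (range f) \<Longrightarrow> (\<And>x. 0 \<le> f x) \<Longrightarrow> 0 \<le> L f"
  and mean_one: "L (\<lambda>_. 1) = 1"
  and mean_shift: "bounded (range f) \<Longrightarrow> L (\<lambda>x. f (x + v)) = L f"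
  using invariant unfolding invariant_mean_def by blast+

lemma mean_const: "L (\<lambda>_. c) = c"
  using mean_scale[of "\<lambda>_. 1" c] mean_one by simp

lemma mean_diff:
  assumes "bounded (range f)" "bounded (range g)"
  shows "L (\<lambda>x. f x - g x) = L f - L g"
  using mean_add[OF bounded_minus_comp[OF assms] assms(2)] by simp

lemma mean_mono:
  assumes "bounded (range f)" "bounded (range g)" "\<And>x. f x \<le> g x"
  shows "L f \<le> L g"
  using mean_nonneg[OF bounded_minus_comp[OF assms(2,1)]] mean_diff[OF assms(2,1)] assms(3) by simp

lemma mean_pos_witness:
  assumes "bounded (range f)" "L f > 0"
  shows "\<exists>x. f x > 0"
proof (rule ccontr)
  assume "\<nexists>x. f x > 0"
  then have "L f \<le> L (\<lambda>_. 0)" using assms by (intro mean_mono) (auto simp: not_less)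
  then show False using assms mean_const[of 0] by simp
qed

definition inner :: "((int^'N) \<Rightarrow>\<^sub>C real) \<Rightarrow> ((int^'N) \<Rightarrow>\<^sub>C real) \<Rightarrow> real" where
  "inner F G = L (\<lambda>x. apply_bcontfun F x * apply_bcontfun G x)"

lemma bounded_mult_bcontfun: "bounded (range (\<lambda>x. apply_bcontfun F x * apply_bcontfun G x :: real))"
  by (intro bounded_mult_range bounded_apply_bcontfun)

sublocale isometric_action inner translate
proof
  fix x y z :: "(int^'N) \<Rightarrow>\<^sub>C real" and a b :: "int^'N" and c :: real
  show "inner x y = inner y x" by (simp add: inner_def mult.commute)
  show "inner (x + y) z = inner x z + inner y z"
    unfolding inner_def by (subst mean_add[symmetric]) (auto simp: bounded_mult_bcontfun algebra_simps)
  show "inner (c *\<^sub>R x) y = c * inner x y"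
    unfolding inner_def by (subst mean_scale[symmetric]) (auto simp: bounded_mult_bcontfun algebra_simps)
  show "0 \<le> inner x x"
    unfolding inner_def by (rule mean_nonneg) (auto simp: bounded_mult_bcontfun)
  show "translate 0 x = x" by (rule bcontfun_eqI) simp
  show "translate (a + b) x = translate a (translate b x)" by (rule bcontfun_eqI) (simp add: add_ac)
  show "translate a (x + y) = translate a x + translate a y" by (rule bcontfun_eqI) simp
  show "translate a (c *\<^sub>R x) = c *\<^sub>R translate a x" by (rule bcontfun_eqI) simp
  show "inner (translate a x) (translate a y) = inner x y"
    unfolding inner_def using mean_shift[OF bounded_mult_bcontfun[of x y], of a] by simp
qed

lemma nrm_mono:
  assumes "0 \<le> c" "\<And>x. \<bar>apply_bcontfun F x\<bar> \<le> c * \<bar>apply_bcontfun G x\<bar>"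
  shows "nrm F \<le> c * nrm G"
proof (rule power2_le_imp_le)
  have "inner F F \<le> L (\<lambda>x. c\<^sup>2 * (apply_bcontfun G x * apply_bcontfun G x))"
    unfolding inner_def
  proof (rule mean_mono)
    fix x
    have "\<bar>apply_bcontfun F x\<bar> * \<bar>apply_bcontfun F x\<bar> \<le> (c * \<bar>apply_bcontfun G x\<bar>) * (c * \<bar>apply_bcontfun G x\<bar>)"
      using assms by (intro mult_mono) auto
    then show "apply_bcontfun F x * apply_bcontfun F x \<le> c\<^sup>2 * (apply_bcontfun G x * apply_bcontfun G x)"
      by (simp add: power2_eq_square mult_ac)
  qed (use bounded_mult_range[OF _ bounded_mult_bcontfun[of G G], of "\<lambda>_. c\<^sup>2"] in
      \<open>auto simp: bounded_mult_bcontfun\<close>)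
  then show "(nrm F)\<^sup>2 \<le> (c * nrm G)\<^sup>2"
    by (simp add: power_mult_distrib nrm_sq mean_scale bounded_mult_bcontfun inner_def)
qed (use assms in auto)

definition one :: "(int^'N) \<Rightarrow>\<^sub>C real" where "one = const_bcontfun 1"

lemma one_apply [simp]: "apply_bcontfun one x = 1"
  by (simp add: one_def)

lemma nrm_one: "nrm one = 1"
  by (simp add: nrm_def inner_def mean_one)

lemma nrm_le:
  assumes "\<And>x. \<bar>apply_bcontfun F x\<bar> \<le> c" shows "nrm F \<le> c"
  using nrm_mono[of c F one] assms order_trans[OF abs_ge_zero assms] by (simp add: nrm_one)

lemma mean_le_nrm: "L (apply_bcontfun F) \<le> nrm F"
  using ip_le_nrm[of F one] by (simp add: nrm_one inner_def)

lemma mean_abs_le_nrm: "L (\<lambda>x. \<bar>apply_bcontfun F x\<bar>) \<le> nrm F"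
proof -
  have b: "bounded (range (\<lambda>x. \<bar>apply_bcontfun F x\<bar>))"
    using bounded_apply_bcontfun[of F] by (simp add: bounded_iff)
  have "L (\<lambda>x. \<bar>apply_bcontfun F x\<bar>) \<le> nrm (Bcontfun (\<lambda>x. \<bar>apply_bcontfun F x\<bar>))"
    using mean_le_nrm[of "Bcontfun (\<lambda>x. \<bar>apply_bcontfun F x\<bar>)"] by (simp add: apply_Bcontfun[OF b])
  also have "\<dots> \<le> 1 * nrm F"
    by (rule nrm_mono) (auto simp: apply_Bcontfun[OF b])
  finally show ?thesis by simp
qed

lemma ops_between:
  assumes "A \<in> ops H" "\<And>x. 0 \<le> apply_bcontfun F x \<and> apply_bcontfun F x \<le> 1"
  shows "0 \<le> apply_bcontfun (A F) x \<and> apply_bcontfun (A F) x \<le> 1"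
  using assms
proof (induction arbitrary: x rule: ops.induct)
  case (comb A B t)
  then have "0 \<le> apply_bcontfun (A F) x \<and> apply_bcontfun (A F) x \<le> 1"
    "0 \<le> apply_bcontfun (B F) x \<and> apply_bcontfun (B F) x \<le> 1" by blast+
  with comb.hyps(3,4) show ?case
    by (simp add: convex_bound_le)
qed simp

text \<open>Turns positivity of an averaged function into an actual translation along which
  \<open>F\<close> is positive.\<close>

lemma ops_witness:
  assumes "A \<in> ops H" "\<And>x. 0 \<le> apply_bcontfun F x" "apply_bcontfun (A F) x > 0"
  shows "\<exists>v\<in>H. apply_bcontfun F (x + v) > 0"
  using assms
proof (induction rule: ops.induct)
  case (comb A B t)
  have "apply_bcontfun (A F) x > 0 \<or> apply_bcontfun (B F) x > 0"
  proof (rule ccontr)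
    assume "\<not> ?thesis"
    then have "t * apply_bcontfun (A F) x \<le> 0" "(1 - t) * apply_bcontfun (B F) x \<le> 0"
      using comb.hyps by (auto simp: mult_nonneg_nonpos)
    then show False using comb.prems by simp
  qed
  then show ?case using comb by blast
qed auto

lemma ops_mean: "A \<in> ops H \<Longrightarrow> L (apply_bcontfun (A F)) = L (apply_bcontfun F)"
proof (induction rule: ops.induct)
  case (base v)
  then show ?case using mean_shift[OF bounded_apply_bcontfun[of F], of v]
    by (metis (no_types, lifting) ext translate_apply)
next
  case (comb A B t)
  have sc: "bounded (range (\<lambda>x. c * apply_bcontfun G x :: real))" for c and G :: "(int^'N) \<Rightarrow>\<^sub>C real"
    using bounded_apply_bcontfun[of "c *\<^sub>R G"] by simp
  have "L (\<lambda>x. t * apply_bcontfun (A F) x + (1 - t) * apply_bcontfun (B F) x) =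
      t * L (apply_bcontfun (A F)) + (1 - t) * L (apply_bcontfun (B F))"
    using mean_add[OF sc sc] mean_scale[OF bounded_apply_bcontfun] by simp
  moreover have "apply_bcontfun (t *\<^sub>R A F + (1 - t) *\<^sub>R B F) =
      (\<lambda>x. t * apply_bcontfun (A F) x + (1 - t) * apply_bcontfun (B F) x)"
    by (rule ext) simp
  ultimately show ?case using comb.IH by (simp add: algebra_simps)
qed

lemma mean_sum:
  assumes "\<And>i. bounded (range (f i))"
  shows "L (\<lambda>x. \<Sum>i\<in>T. f i x) = (\<Sum>i\<in>T. L (f i))"
proof (induction T rule: infinite_finite_induct)
  case (insert i T)
  then show ?case using mean_add[OF assms[of i] bounded_sum_range[where f = f and T = T, OF assms]] by simp
qed (auto simp: mean_const)

text \<open>Jensen's inequality: take the mean of the tangent at \<open>c\<close>, whose linear term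
  vanishes because \<open>c\<close> is the mean of \<open>g\<close>.\<close>

lemma mean_power:
  assumes g: "\<And>x. 0 \<le> apply_bcontfun g x" and c: "L (apply_bcontfun g) = c" "0 < c"
  shows "c ^ Suc n \<le> L (\<lambda>x. apply_bcontfun g x ^ Suc n)"
proof -
  have bg: "bounded (range (\<lambda>x. apply_bcontfun g x - c))"
    by (rule bounded_minus_comp[OF bounded_apply_bcontfun]) simp
  have b1: "bounded (range (\<lambda>x. real (Suc n) * c ^ n * (apply_bcontfun g x - c)))"
    using bounded_mult_range[of "\<lambda>_. real (Suc n) * c ^ n", OF _ bg] by simp
  have "c ^ Suc n = L (\<lambda>x. c ^ Suc n) + real (Suc n) * c ^ n * (L (apply_bcontfun g) - L (\<lambda>_. c))"
    using c by (simp add: mean_const)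
  also have "\<dots> = L (\<lambda>x. c ^ Suc n) + L (\<lambda>x. real (Suc n) * c ^ n * (apply_bcontfun g x - c))"
    by (subst mean_scale[OF bg], subst mean_diff) auto
  also have "\<dots> = L (\<lambda>x. c ^ Suc n + real (Suc n) * c ^ n * (apply_bcontfun g x - c))"
    by (rule mean_add[symmetric, OF _ b1]) auto
  also have "\<dots> \<le> L (\<lambda>x. apply_bcontfun g x ^ Suc n)"
  proof (rule mean_mono)
    show "bounded (range (\<lambda>x. c ^ Suc n + real (Suc n) * c ^ n * (apply_bcontfun g x - c)))"
      by (rule bounded_plus_comp[OF _ b1]) auto
    show "bounded (range (\<lambda>x. apply_bcontfun g x ^ Suc n))"
      using bounded_prod_range[of "\<lambda>_. apply_bcontfun g" "{..n}"] by simp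
    show "c ^ Suc n + real (Suc n) * c ^ n * (apply_bcontfun g x - c) \<le> apply_bcontfun g x ^ Suc n" for x
      by (rule power_tangent[OF g c(2)])
  qed
  finally show ?thesis .
qed

section \<open>Recurrence along polynomial paths\<close>

lemma nrm_diff_unit:
  assumes "\<And>x. 0 \<le> apply_bcontfun F x \<and> apply_bcontfun F x \<le> 1"
    and "\<And>x. 0 \<le> apply_bcontfun G x \<and> apply_bcontfun G x \<le> 1"
  shows "nrm (F - G) \<le> 1"
proof (rule nrm_le)
  fix x show "\<bar>apply_bcontfun (F - G) x\<bar> \<le> 1"
    using assms(1)[of x] assms(2)[of x] unfolding minus_bcontfun.rep_eq by linarith
qed

text \<open>The choices are made in the order \<open>e\<close>, \<open>\<epsilon>\<close>,
  \<open>k\<close>, all before \<open>T\<close> and the paths. Only \<open>card T \<le> m\<close> is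
  asked for, since matrices of \<open>F\<close> may share a determinant; \<open>c \<le> 1\<close>
  makes the estimate for \<open>m\<close> cover smaller sets.\<close>

lemma multiple_recurrence:
  assumes F: "\<And>x. 0 \<le> apply_bcontfun F x \<and> apply_bcontfun F x \<le> 1" and pos: "L (apply_bcontfun F) > 0"
  obtains k :: int where "k > 0"
    "\<And>(T :: 't set) w. finite T \<Longrightarrow> card T \<le> m \<Longrightarrow> (\<And>t. t \<in> T \<Longrightarrow> zspan D (w t) = UNIV) \<Longrightarrow>
      \<exists>x. apply_bcontfun F x > 0 \<and> (\<forall>t\<in>T. \<exists>y. apply_bcontfun F (x + k *s poly_path D (w t) y) > 0)"
proof -
  define c where "c = L (apply_bcontfun F)"
  have nF: "nrm F \<le> 1" using F by (intro nrm_le) (auto simp: abs_le_iff intro: order_trans[of _ 0])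
  have c: "0 < c" "c \<le> 1" using pos mean_le_nrm[of F] nF by (auto simp: c_def)
  \<comment> \<open>The total loss is \<open>3 * M * e\<close> for \<open>M\<close> elements of
    \<open>T\<close>: \<open>M * e\<close> for replacing \<open>F\<close> by \<open>g\<close>
    against \<open>g ^ M\<close>, and \<open>2 * e\<close> for each average. The added 1 keeps the
    final inequality strict.\<close>
  define e where "e = c ^ Suc m / (3 * real m + 1)"
  have e: "e > 0" using c by (simp add: e_def)
  obtain \<epsilon> where \<epsilon>: "\<epsilon> > 0" and level: "\<And>u g w k. nrm (u - g) \<le> 1 \<Longrightarrow> k \<noteq> 0 \<Longrightarrow> small \<epsilon> UNIV (u - g) \<Longrightarrow>
    (\<And>v. nrm (translate (k *s v) g - g) \<le> e) \<Longrightarrow> zspan D w = UNIV \<Longrightarrow>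
    \<exists>A\<in>ops (range (\<lambda>x. k *s poly_path D w x)). nrm (A u - g) \<le> 2 * e"
    using level_averages[OF e, of D] by blast
  obtain k :: int and A where k: "k > 0" and A: "A \<in> ops ((*s) k ` UNIV)"
    and fixd: "\<And>v. nrm (translate (k *s v) (A F) - A F) \<le> min \<epsilon> e" and sm: "small (min \<epsilon> e) UNIV (F - A F)"
    using almost_projection[of UNIV F "min \<epsilon> e"] nF \<epsilon> e by auto
  define g where "g = A F"
  have g01: "0 \<le> apply_bcontfun g x \<and> apply_bcontfun g x \<le> 1" for x
    unfolding g_def by (rule ops_between[OF A F])
  have fixe: "nrm (translate (k *s v) g - g) \<le> e" for v
    using fixd[of v] by (simp add: g_def)
  have sm': "small \<epsilon> UNIV (F - g)"
    using sm unfolding small_def g_def by (meson min.cobounded1 order_trans)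
  have "\<exists>x. apply_bcontfun F x > 0 \<and> (\<forall>t\<in>T. \<exists>y. apply_bcontfun F (x + k *s poly_path D (w t) y) > 0)"
    if T: "finite T" "card T \<le> m" and w: "\<And>t. t \<in> T \<Longrightarrow> zspan D (w t) = UNIV" for T :: "'t set" and w
  proof -
    have "\<forall>t\<in>T. \<exists>P. P \<in> ops (range (\<lambda>x. k *s poly_path D (w t) x)) \<and> nrm (P F - g) \<le> 2 * e"
      using level[OF nrm_diff_unit[OF F g01] _ sm' fixe w] k by (auto simp: Bex_def)
    then obtain P where P: "\<And>t. t \<in> T \<Longrightarrow> P t \<in> ops (range (\<lambda>x. k *s poly_path D (w t) x))"
      "\<And>t. t \<in> T \<Longrightarrow> nrm (P t F - g) \<le> 2 * e"
      by metis
    have P01: "0 \<le> apply_bcontfun (P t F) x \<and> apply_bcontfun (P t F) x \<le> 1" if "t \<in> T" for t x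
      by (rule ops_between[OF P(1)[OF that] F])
    define M where "M = card T"
    define h where "h = Bcontfun (\<lambda>x. apply_bcontfun g x ^ M)"
    have bh: "bounded (range (\<lambda>x. apply_bcontfun g x ^ M))"
      using bounded_prod_range[of "\<lambda>_. apply_bcontfun g" "{..<M}"] by simp
    have h: "apply_bcontfun h x = apply_bcontfun g x ^ M" for x
      unfolding h_def apply_Bcontfun[OF bh] ..
    \<comment> \<open>On [0, 1] the power \<open>M\<close> is Lipschitz with constant
      \<open>M\<close>, so \<open>g ^ M\<close> inherits almost invariance from
      \<open>g\<close>.\<close>
    have "nrm (translate v h - h) \<le> real M * e" if v: "v \<in> (*s) k ` UNIV" for v
    proof -
      obtain v' where v': "v = k *s v'" using v by blast
      have "nrm (translate v h - h) \<le> real M * nrm (translate v g - g)"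
      proof (rule nrm_mono)
        fix x
        have "norm (apply_bcontfun g (x + v) ^ M - apply_bcontfun g x ^ M)
            \<le> M * norm (apply_bcontfun g (x + v) - apply_bcontfun g x)"
          using g01 by (intro norm_power_diff) (auto simp: abs_le_iff intro: order_trans[of _ 0])
        then show "\<bar>apply_bcontfun (translate v h - h) x\<bar> \<le> real M * \<bar>apply_bcontfun (translate v g - g) x\<bar>"
          by (simp add: h)
      qed simp
      also have "\<dots> \<le> real M * e" unfolding v' by (intro mult_left_mono fixe) simp
      finally show ?thesis .
    qed
    then have "\<bar>inner g h - inner F h\<bar> \<le> nrm F * (real M * e)"
      unfolding g_def by (intro ops_ip_almost_fixed[OF A]) auto
    also have "\<dots> \<le> 1 * (real M * e)" using nF e by (intro mult_right_mono) auto
    finally have "inner g h - real M * e \<le> inner F h" by simp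
    moreover have "c ^ Suc M \<le> inner g h"
    proof -
      have "L (apply_bcontfun g) = c" unfolding g_def c_def by (rule ops_mean[OF A])
      then show ?thesis using mean_power[of g c M] g01 c by (simp add: inner_def h)
    qed
    moreover have "c ^ Suc m \<le> c ^ Suc M"
      using c T by (intro power_decreasing) (auto simp: M_def)
    ultimately have 1: "c ^ Suc m - real M * e \<le> L (\<lambda>x. apply_bcontfun F x * apply_bcontfun g x ^ M)"
      by (simp add: inner_def h)
    let ?D = "\<lambda>t x. \<bar>apply_bcontfun (P t F - g) x\<bar>"
    have bD: "bounded (range (?D t))" for t
      using bounded_apply_bcontfun[of "P t F - g"] unfolding bounded_iff by (simp only: real_norm_def abs_abs ball_simps)
    have bFP: "bounded (range (\<lambda>x. apply_bcontfun F x * (\<Prod>t\<in>T. apply_bcontfun (P t F) x)))"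
      by (intro bounded_mult_range bounded_prod_range bounded_apply_bcontfun)
    have bFg: "bounded (range (\<lambda>x. apply_bcontfun F x * apply_bcontfun g x ^ M))"
      by (intro bounded_mult_range bh bounded_apply_bcontfun)
    have "L (\<lambda>x. apply_bcontfun F x * apply_bcontfun g x ^ M) - (\<Sum>t\<in>T. L (?D t))
        = L (\<lambda>x. apply_bcontfun F x * apply_bcontfun g x ^ M - (\<Sum>t\<in>T. ?D t x))"
      by (subst mean_diff[OF bFg bounded_sum_range[OF bD]]) (simp only: mean_sum[OF bD])
    also have "\<dots> \<le> L (\<lambda>x. apply_bcontfun F x * (\<Prod>t\<in>T. apply_bcontfun (P t F) x))"
    proof (rule mean_mono[OF bounded_minus_comp[OF bFg bounded_sum_range[OF bD]] bFP])
      fix x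
      \<comment> \<open>All factors lie in [0, 1], so replacing them one at a time costs at most the
        sum of the individual differences.\<close>
      have "norm ((\<Prod>t\<in>T. apply_bcontfun (P t F) x) - (\<Prod>t\<in>T. apply_bcontfun g x)) \<le>
          (\<Sum>t\<in>T. norm (apply_bcontfun (P t F) x - apply_bcontfun g x))"
        using P01 g01 by (intro norm_prod_diff) (auto simp: abs_le_iff intro: order_trans[of _ 0])
      then have "\<bar>(\<Prod>t\<in>T. apply_bcontfun (P t F) x) - apply_bcontfun g x ^ M\<bar> \<le> (\<Sum>t\<in>T. ?D t x)"
        by (simp add: M_def)
      moreover have "\<bar>apply_bcontfun F x * ((\<Prod>t\<in>T. apply_bcontfun (P t F) x) - apply_bcontfun g x ^ M)\<bar>
          \<le> \<bar>(\<Prod>t\<in>T. apply_bcontfun (P t F) x) - apply_bcontfun g x ^ M\<bar>"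
        using F[of x] by (simp add: abs_mult mult_left_le_one_le)
      ultimately show "apply_bcontfun F x * apply_bcontfun g x ^ M - (\<Sum>t\<in>T. ?D t x)
          \<le> apply_bcontfun F x * (\<Prod>t\<in>T. apply_bcontfun (P t F) x)"
        unfolding right_diff_distrib by linarith
    qed
    finally have 2: "L (\<lambda>x. apply_bcontfun F x * apply_bcontfun g x ^ M) - (\<Sum>t\<in>T. L (?D t))
        \<le> L (\<lambda>x. apply_bcontfun F x * (\<Prod>t\<in>T. apply_bcontfun (P t F) x))" .
    have "(\<Sum>t\<in>T. L (?D t)) \<le> (\<Sum>t\<in>T. 2 * e)"
      by (intro sum_mono order_trans[OF mean_abs_le_nrm] P(2))
    then have 3: "(\<Sum>t\<in>T. L (?D t)) \<le> 2 * real M * e" by (simp add: M_def)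
    have "3 * real M * e \<le> 3 * real m * e" using T e by (simp add: M_def)
    moreover have "3 * real m * e < c ^ Suc m" using c by (simp add: e_def field_simps)
    ultimately have "0 < L (\<lambda>x. apply_bcontfun F x * (\<Prod>t\<in>T. apply_bcontfun (P t F) x))"
      using 1 2 3 by linarith
    from mean_pos_witness[OF bFP this] obtain x where
      x: "0 < apply_bcontfun F x * (\<Prod>t\<in>T. apply_bcontfun (P t F) x)" by blast
    then have "0 < apply_bcontfun F x" using F[of x] by (auto simp: zero_less_mult_iff)
    moreover have "\<exists>y. apply_bcontfun F (x + k *s poly_path D (w t) y) > 0" if t: "t \<in> T" for t
    proof -
      have "apply_bcontfun (P t F) x \<noteq> 0"
      proof -
        have "(\<Prod>t\<in>T. apply_bcontfun (P t F) x) \<noteq> 0" using x by auto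
        then show ?thesis using t by (simp add: prod_zero_iff[OF T(1)])
      qed
      then have "apply_bcontfun (P t F) x > 0" using P01[OF t, of x] by simp
      then show ?thesis using ops_witness[OF P(1)[OF t]] F by blast
    qed
    ultimately show ?thesis by blast
  qed
  with k that show thesis by blast
qed

text \<open>By \<open>stab\<close>, passing to multiples of \<open>q\<close> does not lengthen the
  shortest averages, so \<open>almost_projection_at\<close> applies with \<open>k = 1\<close> and
  \<open>g\<close> is almost invariant under all translations. Both \<open>F\<close> shifted by
  \<open>a\<close> and its path average can then be compared with \<open>g\<close>.\<close>

lemma recurrence_unscaled:
  assumes F: "\<And>x. 0 \<le> apply_bcontfun F x \<and> apply_bcontfun F x \<le> 1" and pos: "L (apply_bcontfun F) > 0"
    and stab: "\<And>q. q \<noteq> 0 \<Longrightarrow> hull_dist ((*s) q ` UNIV) F \<le> hull_dist UNIV F"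
    and w: "zspan D w = UNIV"
  shows "\<exists>z y. apply_bcontfun F (z + a) > 0 \<and> apply_bcontfun F (z + poly_path D w y) > 0"
proof -
  define c where "c = L (apply_bcontfun F)"
  have nF: "nrm F \<le> 1" using F by (intro nrm_le) (auto simp: abs_le_iff intro: order_trans[of _ 0])
  have c: "0 < c" using pos by (auto simp: c_def)
  \<comment> \<open>The losses are \<open>e\<close> and \<open>e\<close> for the translation by
    \<open>a\<close> and \<open>2 * e\<close> for the path average, together half of
    \<open>c\<^sup>2\<close>.\<close>
  define e where "e = c\<^sup>2 / 8"
  have e: "e > 0" using c by (simp add: e_def)
  obtain \<epsilon> where \<epsilon>: "\<epsilon> > 0" and level: "\<And>u g w k. nrm (u - g) \<le> 1 \<Longrightarrow> k \<noteq> 0 \<Longrightarrow> small \<epsilon> UNIV (u - g) \<Longrightarrow>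
    (\<And>v. nrm (translate (k *s v) g - g) \<le> e) \<Longrightarrow> zspan D w = UNIV \<Longrightarrow>
    \<exists>A\<in>ops (range (\<lambda>x. k *s poly_path D w x)). nrm (A u - g) \<le> 2 * e"
    using level_averages[OF e, of D] by blast
  define e' where "e' = min \<epsilon> e"
  have e': "e' > 0" using \<epsilon> e by (simp add: e'_def)
  define d where "d = min (1/2) ((e'/2)\<^sup>2 / 24)"
  have d: "0 < d" "2 * d \<le> 1" "24 * d \<le> (e'/2)\<^sup>2" using e' by (auto simp: d_def min_def)
  have one: "(*s) 1 ` (UNIV :: (int^'N) set) = UNIV" by (simp add: image_def)
  have "\<exists>A\<in>ops ((*s) 1 ` UNIV). (\<forall>v\<in>UNIV. nrm (translate (1 *s v) (A F) - A F) \<le> e') \<and> small e' UNIV (F - A F)"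
  proof (rule almost_projection_at[OF _ _ _ _ nF e' d])
    fix q :: int assume "q \<noteq> 0"
    then show "hull_dist ((*s) q ` UNIV) F \<le> hull_dist ((*s) 1 ` UNIV) F + d"
      using stab[of q] d(1) unfolding one by simp
  qed auto
  then obtain A where A: "A \<in> ops UNIV" and fixd: "\<And>v. nrm (translate v (A F) - A F) \<le> e'"
    and sm: "small e' UNIV (F - A F)"
    unfolding one by auto
  define g where "g = A F"
  have g01: "0 \<le> apply_bcontfun g x \<and> apply_bcontfun g x \<le> 1" for x
    unfolding g_def by (rule ops_between[OF A F])
  have ng: "nrm g \<le> 1" using ops_nrm[OF A, of F] nF by (simp add: g_def)
  have fixe: "nrm (translate v g - g) \<le> e" for v
    using fixd[of v] by (simp add: g_def e'_def)
  have "small \<epsilon> UNIV (F - g)"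
    using sm unfolding small_def g_def e'_def by (meson min.cobounded1 order_trans)
  then have "\<exists>P\<in>ops (range (\<lambda>x. 1 *s poly_path D w x)). nrm (P F - g) \<le> 2 * e"
    using fixe w by (intro level nrm_diff_unit F g01) auto
  then obtain P where P: "P \<in> ops (range (poly_path D w))" "nrm (P F - g) \<le> 2 * e" by auto
  let ?F = "translate a F"
  have "\<bar>inner (A ?F) g - inner ?F g\<bar> \<le> nrm ?F * e"
    by (rule ops_ip_almost_fixed[OF A]) (rule fixe)
  also have "\<dots> \<le> 1 * e" using nF e by (intro mult_right_mono) auto
  finally have 1: "inner (translate a g) g - e \<le> inner ?F g"
    by (simp add: g_def ops_U_comm[OF A])
  have "\<bar>inner (translate a g - g) g\<bar> \<le> nrm (translate a g - g) * nrm g" by (rule ip_le_nrm)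
  also have "\<dots> \<le> e * 1" using fixe ng e by (intro mult_mono) auto
  finally have 2: "inner g g - e \<le> inner (translate a g) g" by (simp add: ip_diff_left)
  have "c \<le> nrm g" using mean_le_nrm[of g] ops_mean[OF A, of F] by (simp add: g_def c_def)
  then have 3: "c\<^sup>2 \<le> inner g g" using c by (simp add: power_mono flip: nrm_sq)
  have "\<bar>inner ?F (P F - g)\<bar> \<le> nrm ?F * nrm (P F - g)" by (rule ip_le_nrm)
  also have "\<dots> \<le> 1 * (2 * e)" using nF e P(2) by (intro mult_mono) auto
  finally have "inner ?F g - 2 * e \<le> inner ?F (P F)" by (simp add: ip_diff_right)
  then have "0 < inner ?F (P F)" using 1 2 3 e unfolding e_def by linarith
  from mean_pos_witness[OF bounded_mult_bcontfun this[unfolded inner_def]]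
  obtain z where z: "0 < apply_bcontfun F (z + a) * apply_bcontfun (P F) z" by auto
  then have "0 < apply_bcontfun F (z + a)" "0 < apply_bcontfun (P F) z"
    using F[of "z + a"] by (auto simp: zero_less_mult_iff)
  then show ?thesis using ops_witness[OF P(1), of F z] F by blast
qed

text \<open>Supplies the hypothesis \<open>stab\<close> of \<open>recurrence_unscaled\<close>: every
  translation of \<open>F\<close> can be exchanged for one from \<open>H\<close> at arbitrarily
  small uniform cost.\<close>

lemma hull_dist_le_of_uniform_approx:
  assumes "\<And>v d. d > 0 \<Longrightarrow> \<exists>v'\<in>H. \<forall>x. \<bar>apply_bcontfun F (x + v) - apply_bcontfun F (x + v')\<bar> \<le> d"
  shows "hull_dist H F \<le> hull_dist UNIV F"
proof (rule field_le_epsilon)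
  fix e :: real assume e: "e > 0"
  obtain A where A: "A \<in> ops UNIV" "nrm (A F) < hull_dist UNIV F + e/2"
    using hull_dist_attained[of UNIV "e/2" F] e by auto
  have "\<exists>A'\<in>ops H. nrm (A F - A' F) \<le> e/2"
  proof (rule ops_project[OF A(1)])
    fix v
    obtain v' where v': "v' \<in> H" "\<And>x. \<bar>apply_bcontfun F (x + v) - apply_bcontfun F (x + v')\<bar> \<le> e/2"
      using assms[of "e/2" v] e by auto
    then have "nrm (translate v F - translate v' F) \<le> e/2" by (intro nrm_le) simp
    then show "\<exists>a\<in>H. nrm (translate v F - translate a F) \<le> e/2" using v'(1) by blast
  qed
  then obtain A' where A': "A' \<in> ops H" "nrm (A F - A' F) \<le> e/2" by blast
  have "hull_dist H F \<le> nrm (A' F)" by (rule hull_dist_le[OF A'(1)])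
  also have "\<dots> \<le> nrm (A F) + nrm (A F - A' F)"
    using nrm_le_diff[of "A' F" "A F"] by (simp add: nrm_minus_commute)
  finally show "hull_dist H F \<le> hull_dist UNIV F + e" using A(2) A'(2) by simp
qed

end

section \<open>Coordinates of symmetric matrices\<close>

lemma from_coords_add: "from_coords B (x + y) = from_coords B x + from_coords B y"
  by (simp add: from_coords_def vec_eq_iff sum.distrib distrib_right)

text \<open>Written row by row so that \<open>det_rows_mul\<close> extracts one factor
  \<open>c\<close> from each row.\<close>

lemma from_coords_scale: "from_coords B (c *s x) = (\<chi> i. c *s from_coords B x $ i)"
  by (simp add: from_coords_def vec_eq_iff sum_distrib_left mult.assoc)

lemma from_coords_sum: "from_coords B (\<Sum>m\<in>M. f m) = (\<Sum>m\<in>M. from_coords B (f m))"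
proof (induction M rule: infinite_finite_induct)
  case empty
  show ?case by (simp add: from_coords_def vec_eq_iff)
next
  case infinite
  then show ?case by (simp add: from_coords_def vec_eq_iff)
qed (simp add: from_coords_add)

lemma from_coords_sum_scale_nth:
  "from_coords B (\<Sum>m\<in>M. f m *s w m) $ i $ j = (\<Sum>m\<in>M. f m * from_coords B (w m) $ i $ j)"
  by (simp add: from_coords_sum from_coords_scale)

lemma det_from_coords_scale:
  fixes B :: "'N::finite \<Rightarrow> int^'n^'n"
  shows "det (from_coords B (c *s x)) = c ^ CARD('n) * det (from_coords B x)"
  unfolding from_coords_scale by (subst det_rows_mul) simp

lemma det_level_path_coords:
  fixes B :: "'N::finite \<Rightarrow> int^'n^'n"
  assumes d: "CARD('n) \<ge> 2" and B: "Z_basis_of_Sym B"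
  obtains D w where "\<And>t. zspan D (w t) = UNIV" "\<And>t y. det (from_coords B (poly_path D (w t) y)) = t"
proof -
  obtain D where D: "\<And>t. \<exists>V :: nat \<Rightarrow> int^'n^'n. (\<forall>m. V m \<in> Sym) \<and>
     (\<forall>x. det (\<chi> i j. \<Sum>m\<le>D. x ^ m * V m $ i $ j) = t) \<and>
     (\<forall>A\<in>Sym. \<exists>c. \<forall>i j. A $ i $ j = (\<Sum>m=1..D. c m * V m $ i $ j))"
    using det_level_path[OF d] by blast
  have bij: "bij_betw (from_coords B) UNIV Sym" using B by (simp add: Z_basis_of_Sym_def)
  have "\<exists>w. zspan D w = UNIV \<and> (\<forall>y. det (from_coords B (poly_path D w y)) = t)" for t
  proof -
    obtain V :: "nat \<Rightarrow> int^'n^'n" where V: "\<And>m. V m \<in> Sym"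
      "\<And>x. det (\<chi> i j. \<Sum>m\<le>D. x ^ m * V m $ i $ j) = t"
      "\<And>A. A \<in> Sym \<Longrightarrow> \<exists>c. \<forall>i j. A $ i $ j = (\<Sum>m=1..D. c m * V m $ i $ j)"
      using D[of t] by blast
    define w where "w m = inv_into UNIV (from_coords B) (V m)" for m
    have w: "from_coords B (w m) = V m" for m
      unfolding w_def using V(1)[of m] bij by (intro f_inv_into_f) (auto simp: bij_betw_def)
    have path: "from_coords B (poly_path D w y) = (\<chi> i j. \<Sum>m\<le>D. y ^ m * V m $ i $ j)" for y
      by (simp add: vec_eq_iff poly_path_def from_coords_sum_scale_nth w)
    have "z \<in> zspan D w" for z
    proof -
      have "from_coords B z \<in> Sym" using bij by (auto simp: bij_betw_def)
      then obtain c where c: "\<And>i j. from_coords B z $ i $ j = (\<Sum>m=1..D. c m * V m $ i $ j)"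
        using V(3) by blast
      have "from_coords B z = from_coords B (\<Sum>m=1..D. c m *s w m)"
        by (simp add: vec_eq_iff c from_coords_sum_scale_nth w)
      then have "z = (\<Sum>m=1..D. c m *s w m)"
        using bij by (simp add: bij_betw_def inj_eq)
      then show ?thesis by (auto simp: zspan_def)
    qed
    then have "zspan D w = UNIV" by blast
    with path show ?thesis using V(2) by (intro exI[of _ w]) simp
  qed
  then obtain w where "\<And>t. zspan D (w t) = UNIV \<and> (\<forall>y. det (from_coords B (poly_path D (w t) y)) = t)"
    by metis
  then show thesis using that by blast
qed

text \<open>Recurrence is applied to the set of determinants of the pattern, with one path for each
  value. Scaling the path by \<open>k\<close> produces the factor
  \<open>k ^ CARD('n)\<close>.\<close>

lemma det_patterns_of_positive_density:
  fixes B :: "'N::finite \<Rightarrow> int^'n^'n"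
  assumes d: "CARD('n) \<ge> 2" and B: "Z_basis_of_Sym B"
    and E: "upper_Banach_density (from_coords B -` E) > 0"
  shows "\<exists>k>0. det_patterns k m E"
proof -
  let ?E = "from_coords B -` E"
  obtain L where L: "invariant_mean L" "L (indicator ?E) > 0"
    using positive_density_mean[OF E] by blast
  interpret bounded_mean L by standard (rule L(1))
  define F where "F = Bcontfun (indicator ?E :: int^'N \<Rightarrow> real)"
  have "bounded (range (indicator ?E :: int^'N \<Rightarrow> real))"
    by (auto simp: bounded_iff indicator_def intro!: exI[of _ 1])
  then have F: "apply_bcontfun F = indicator ?E" unfolding F_def by (rule apply_Bcontfun)
  have pos: "apply_bcontfun F x > 0 \<Longrightarrow> from_coords B x \<in> E" for x
    by (auto simp: F indicator_def split: if_splits)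
  obtain D w where w: "\<And>t. zspan D (w t) = UNIV" "\<And>t y. det (from_coords B (poly_path D (w t) y)) = t"
    using det_level_path_coords[OF d B] by blast
  have F01: "0 \<le> apply_bcontfun F x \<and> apply_bcontfun F x \<le> 1" for x
    by (simp add: F indicator_def)
  have "L (apply_bcontfun F) > 0" using L(2) by (simp add: F)
  then obtain k :: int where k: "k > 0" and rec:
    "\<And>(T :: int set) w. finite T \<Longrightarrow> card T \<le> m \<Longrightarrow> (\<And>t. t \<in> T \<Longrightarrow> zspan D (w t) = UNIV) \<Longrightarrow>
      \<exists>x. apply_bcontfun F x > 0 \<and> (\<forall>t\<in>T. \<exists>y. apply_bcontfun F (x + k *s poly_path D (w t) y) > 0)"
    using multiple_recurrence[OF F01, of m D] by blast
  have "det_patterns (nat k) m E"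
    unfolding det_patterns_def
  proof (intro allI impI)
    fix M :: "(int^'n^'n) set" assume M: "M \<subseteq> Sym \<and> finite M \<and> card M = m"
    then have "finite (det ` M)" "card (det ` M) \<le> m" by (auto intro: card_image_le)
    then obtain x where x: "apply_bcontfun F x > 0"
      "\<And>t. t \<in> det ` M \<Longrightarrow> \<exists>y. apply_bcontfun F (x + k *s poly_path D (w t) y) > 0"
      using rec[of "det ` M" w] w(1) by blast
    let ?b = "from_coords B x"
    have "int (nat k) ^ CARD('n) * det f \<in> det ` (\<lambda>e. e - ?b) ` E" if f: "f \<in> M" for f
    proof -
      obtain y where y: "apply_bcontfun F (x + k *s poly_path D (w (det f)) y) > 0"
        using x(2) f by blast
      let ?e = "from_coords B (x + k *s poly_path D (w (det f)) y)"
      have "det (?e - ?b) = k ^ CARD('n) * det f"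
        by (simp add: from_coords_add det_from_coords_scale w(2))
      moreover have "?e \<in> E" using pos[OF y] .
      ultimately show ?thesis using k by (auto simp: image_iff intro!: bexI[of _ ?e])
    qed
    then show "\<exists>b\<in>E. (\<lambda>f. int (nat k) ^ CARD('n) * det f) ` M \<subseteq> det ` (\<lambda>e. e - b) ` E"
      using pos[OF x(1)] by blast
  qed
  then show ?thesis using k by (intro exI[of _ "nat k"]) simp
qed

section \<open>Homomorphisms into connected compact groups\<close>

locale dense_hom =
  fixes \<tau> :: "int^'N::finite \<Rightarrow> 'k::{topological_ab_group_add, second_countable_topology, t2_space}"
  assumes add: "\<tau> (x + y) = \<tau> x + \<tau> y"
    and dense: "closure (range \<tau>) = UNIV"
    and compact: "compact (UNIV :: 'k set)"
begin

lemma zero: "\<tau> 0 = 0"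
  using add[of 0 0] by simp

lemma diff: "\<tau> (x - y) = \<tau> x - \<tau> y"
  using add[of "x - y" y] by (simp add: algebra_simps)

lemma meets_open:
  assumes "open V" "V \<noteq> {}" shows "\<exists>x. \<tau> x \<in> V"
  using assms dense open_Int_closure_eq_empty[of V "range \<tau>"] by auto

text \<open>Connectedness enters here: finitely many translates of the closure \<open>H\<close>, by
  residues modulo \<open>q\<close>, cover the group, so \<open>H\<close> is open and closed.\<close>

lemma dense_multiples:
  assumes conn: "connected (UNIV :: 'k set)" and q: "q \<noteq> 0"
  shows "closure (\<tau> ` (*s) q ` UNIV) = UNIV"
proof -
  define S where "S = \<tau> ` (*s) q ` UNIV"
  define H where "H = closure S"
  have S_diff: "a - b \<in> S" if ab: "a \<in> S" "b \<in> S" for a b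
  proof -
    obtain x y where "a = \<tau> (q *s x)" "b = \<tau> (q *s y)" using ab by (auto simp: S_def)
    then have "a - b = \<tau> (q *s (x - y))" by (simp add: diff vector_ssub_ldistrib)
    then show ?thesis unfolding S_def by blast
  qed
  have H_closed: "closed H" by (simp add: H_def)
  have SH: "S \<subseteq> H" by (simp add: H_def closure_subset)
  have minimal: "H \<subseteq> T" if "S \<subseteq> T" "closed T" for T
    unfolding H_def using that by (rule closure_minimal)
  have pre: "closed (f -` H)" if "continuous_on UNIV f" for f :: "'k \<Rightarrow> 'k"
    using continuous_closed_vimage[OF H_closed] that by (auto simp: continuous_on_eq_continuous_at)
  \<comment> \<open>The closure of a subgroup is a subgroup; differences are extended to the closure
    in one argument at a time.\<close>
  have "H \<subseteq> (\<lambda>b. a - b) -` H" if "a \<in> S" for a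
    using that S_diff SH by (intro minimal pre continuous_intros) auto
  then have "H \<subseteq> (\<lambda>a. a - b) -` H" if "b \<in> H" for b
    using that by (intro minimal pre continuous_intros) auto
  then have H_diff: "a - b \<in> H" if "a \<in> H" "b \<in> H" for a b using that by auto
  have "\<tau> (q *s 0) \<in> S" unfolding S_def by blast
  then have H0: "0 \<in> H" using SH zero by auto
  define R :: "(int^'N) set" where "R = {x. \<forall>i. 0 \<le> x $ i \<and> x $ i < \<bar>q\<bar>}"
  have "finite R"
  proof -
    have "R \<subseteq> (\<lambda>f. \<chi> i. f i) ` PiE UNIV (\<lambda>_. {0..<\<bar>q\<bar>})"
    proof
      fix x assume "x \<in> R"
      then show "x \<in> (\<lambda>f. \<chi> i. f i) ` PiE UNIV (\<lambda>_. {0..<\<bar>q\<bar>})"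
        by (intro image_eqI[of _ _ "\<lambda>i. x $ i"]) (auto simp: R_def)
    qed
    then show ?thesis by (rule finite_subset) (simp add: finite_PiE)
  qed
  let ?C = "\<lambda>r. (\<lambda>z. z - \<tau> r) -` H"
  have C_closed: "closed (?C r)" for r
    by (intro pre continuous_intros)
  have "range \<tau> \<subseteq> (\<Union>r\<in>R. ?C r)"
  proof
    fix z assume "z \<in> range \<tau>"
    then obtain v where v: "z = \<tau> v" by blast
    define r where "r = (\<chi> i. v $ i mod \<bar>q\<bar>)"
    have "r \<in> R" using q by (simp add: R_def r_def)
    \<comment> \<open>The residues are taken modulo \<open>\<bar>q\<bar>\<close>;
      \<open>sgn q\<close> corrects the quotient for negative \<open>q\<close>.\<close>
    have "v - r = q *s (\<chi> i. sgn q * (v $ i div \<bar>q\<bar>))"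
    proof -
      have "v $ i - v $ i mod \<bar>q\<bar> = q * (sgn q * (v $ i div \<bar>q\<bar>))" for i
        using minus_mod_eq_mult_div[of "v $ i" "\<bar>q\<bar>"] by (simp add: abs_sgn mult_ac)
      then show ?thesis by (simp add: vec_eq_iff r_def)
    qed
    then have "z - \<tau> r \<in> S" unfolding v S_def diff[symmetric] by blast
    then show "z \<in> (\<Union>r\<in>R. ?C r)" using \<open>r \<in> R\<close> SH by auto
  qed
  then have "closure (range \<tau>) \<subseteq> (\<Union>r\<in>R. ?C r)"
    using \<open>finite R\<close> C_closed by (intro closure_minimal closed_UN) auto
  then have cover: "(\<Union>r\<in>R. ?C r) = UNIV" unfolding dense by blast
  \<comment> \<open>The closed subgroup \<open>H\<close> has finite index, hence is open.\<close>
  have "- H = (\<Union>r\<in>{r \<in> R. \<tau> r \<notin> H}. ?C r)"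
  proof (intro equalityI subsetI)
    fix z assume z: "z \<in> - H"
    have "z \<in> (\<Union>r\<in>R. ?C r)" unfolding cover by simp
    then obtain r where r: "r \<in> R" "z - \<tau> r \<in> H" by auto
    have "\<tau> r \<notin> H"
    proof
      assume "\<tau> r \<in> H"
      from H_diff[OF r(2) H_diff[OF H0 this]] show False using z by simp
    qed
    then show "z \<in> (\<Union>r\<in>{r \<in> R. \<tau> r \<notin> H}. ?C r)" using r by auto
  next
    fix z assume "z \<in> (\<Union>r\<in>{r \<in> R. \<tau> r \<notin> H}. ?C r)"
    then obtain r where r: "\<tau> r \<notin> H" "z - \<tau> r \<in> H" by auto
    show "z \<in> - H"
    proof
      assume "z \<in> H"
      from H_diff[OF this r(2)] show False using r(1) by simp
    qed
  qed
  moreover have "closed (\<Union>r\<in>{r \<in> R. \<tau> r \<notin> H}. ?C r)"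
    using \<open>finite R\<close> C_closed by (intro closed_UN) auto
  ultimately have "closed (- H)" by simp
  then have "H \<inter> UNIV = {} \<or> - H \<inter> UNIV = {}"
    using H_closed by (intro connectedD[OF conn]) (auto simp: closed_def)
  then show ?thesis using H0 by (auto simp: H_def S_def)
qed

text \<open>By compactness, in the form of the tube lemma, all shifts from some neighbourhood of 0
  change \<open>\<phi>\<close> by less than \<open>d\<close> everywhere. Density of the multiples of
  \<open>q\<close> gives \<open>v'\<close> with \<open>\<tau> v' - \<tau> v\<close> in it.\<close>

lemma uniform_approx:
  fixes \<phi> :: "'k \<Rightarrow> real"
  assumes \<phi>: "continuous_on UNIV \<phi>" and conn: "connected (UNIV :: 'k set)" and q: "q \<noteq> 0" and d: "d > 0"
  shows "\<exists>v'\<in>(*s) q ` UNIV. \<forall>x. \<bar>\<phi> (\<tau> (x + v)) - \<phi> (\<tau> (x + v'))\<bar> \<le> d"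
proof -
  define W where "W = {p. \<bar>\<phi> (snd p + \<tau> v) - \<phi> (snd p + \<tau> v + fst p)\<bar> < d}"
  have cont: "continuous_on UNIV (\<lambda>p :: 'k \<times> 'k. \<phi> (f p))" if "continuous_on UNIV f" for f
    using continuous_on_compose2[OF \<phi> that] by simp
  have "open W"
    unfolding W_def by (intro open_Collect_less continuous_intros cont)
  moreover have "{0} \<times> UNIV \<subseteq> W" using d by (auto simp: W_def)
  ultimately obtain X where X: "0 \<in> X" "open X" "X \<times> UNIV \<subseteq> W"
    using Elementary_Topology.tube_lemma[OF compact, of W 0] by blast
  have "open ((\<lambda>y. y - \<tau> v) -` X)"
    using X(2) by (intro open_vimage continuous_intros)
  moreover have "\<tau> v \<in> (\<lambda>y. y - \<tau> v) -` X" using X(1) by simp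
  ultimately have "(\<lambda>y. y - \<tau> v) -` X \<inter> \<tau> ` (*s) q ` UNIV \<noteq> {}"
    using open_Int_closure_eq_empty[of "(\<lambda>y. y - \<tau> v) -` X" "\<tau> ` (*s) q ` UNIV"]
    unfolding dense_multiples[OF conn q] by blast
  then obtain v' where v': "v' \<in> (*s) q ` UNIV" "\<tau> v' - \<tau> v \<in> X" by auto
  have "\<bar>\<phi> (\<tau> (x + v)) - \<phi> (\<tau> (x + v'))\<bar> \<le> d" for x
  proof -
    have "(\<tau> v' - \<tau> v, \<tau> x) \<in> W" using v'(2) X(3) by blast
    then show ?thesis by (simp add: W_def add)
  qed
  then show ?thesis using v'(1) by blast
qed

text \<open>Urysohn's lemma for a neighbourhood \<open>W\<close> of 0 with \<open>W - W\<close>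
  inside \<open>V\<close>. Differences are controlled because recurrence delivers two points with
  positive values of \<open>\<phi>\<close> and nothing about either of them alone.\<close>

lemma bump:
  assumes "open V" "0 \<in> V"
  obtains \<phi> :: "'k \<Rightarrow> real" where "continuous_on UNIV \<phi>" "\<And>z. 0 \<le> \<phi> z \<and> \<phi> z \<le> 1" "\<phi> 0 = 1"
    "\<And>y z. \<phi> y > 0 \<Longrightarrow> \<phi> z > 0 \<Longrightarrow> y - z \<in> V"
proof -
  have "open ((\<lambda>p. fst p - snd p) -` V)"
    using assms(1) by (intro open_vimage continuous_intros)
  then obtain X Y where XY: "open X" "open Y" "(0, 0) \<in> X \<times> Y" "X \<times> Y \<subseteq> (\<lambda>p. fst p - snd p) -` V"
    using assms(2) by (elim open_prod_elim[of _ "(0, 0)"]) auto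
  define W where "W = X \<inter> Y"
  have W: "open W" "0 \<in> W" using XY by (auto simp: W_def)
  have "Hausdorff_space (euclidean :: 'k topology)"
    by (simp add: Hausdorff_space_def disjnt_def) (metis hausdorff)
  moreover have "compact_space (euclidean :: 'k topology)"
    using compact by (simp add: compact_space_def)
  ultimately have "normal_space (euclidean :: 'k topology)"
    using compact_Hausdorff_or_regular_imp_normal_space by blast
  then obtain \<phi> where \<phi>: "continuous_map (euclidean :: 'k topology) (top_of_set {0..1::real}) \<phi>"
    "\<phi> ` (- W) \<subseteq> {0}" "\<phi> ` {0} \<subseteq> {1}"
    using W by (elim Urysohn_lemma[of _ "- W" "{0}" 0 1]) (auto simp: disjnt_def closed_def)
  have "continuous_on UNIV \<phi>" "\<And>z. 0 \<le> \<phi> z \<and> \<phi> z \<le> 1"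
    using \<phi>(1) by (auto simp: continuous_map_in_subtopology)
  moreover have "\<phi> 0 = 1" using \<phi>(3) by auto
  moreover have "y - z \<in> V" if "\<phi> y > 0" "\<phi> z > 0" for y z
  proof -
    have "y \<in> W" "z \<in> W" using \<phi>(2) that by force+
    then show ?thesis using XY(4) by (auto simp: W_def)
  qed
  ultimately show thesis using that by blast
qed

text \<open>Fix \<open>a\<close> with \<open>\<tau> a\<close> in \<open>V\<close> and a bump whose
  support differences lie in \<open>V - \<tau> a\<close>. Recurrence gives \<open>z\<close> for
  which shifting by \<open>a\<close> and by a point of the path both hit the bump; subtracting puts
  that point's image in \<open>V\<close>.\<close>

lemma level_path_dense:
  assumes conn: "connected (UNIV :: 'k set)" and V: "open V" "V \<noteq> {}" and w: "zspan D w = UNIV"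
  shows "\<exists>y. \<tau> (poly_path D w y) \<in> V"
proof -
  obtain a where a: "\<tau> a \<in> V" using meets_open[OF V] by blast
  have "open ((\<lambda>s. s + \<tau> a) -` V)" using V by (intro open_vimage continuous_intros)
  then obtain \<phi> :: "'k \<Rightarrow> real" where \<phi>: "continuous_on UNIV \<phi>" "\<And>z. 0 \<le> \<phi> z \<and> \<phi> z \<le> 1" "\<phi> 0 = 1"
    "\<And>y z. \<phi> y > 0 \<Longrightarrow> \<phi> z > 0 \<Longrightarrow> y - z \<in> (\<lambda>s. s + \<tau> a) -` V"
    using a by (elim bump) auto
  obtain L :: "(int^'N \<Rightarrow> real) \<Rightarrow> real" where L: "invariant_mean L"
    using ex_invariant_mean[of sequentially "\<lambda>_. 0"] by (metis order_refl sequentially_bot)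
  interpret bounded_mean L by standard (rule L)
  define F where "F = Bcontfun (\<lambda>x. \<phi> (\<tau> x))"
  have "bounded (range (\<lambda>x. \<phi> (\<tau> x)))"
    using \<phi>(2) by (auto simp: bounded_iff abs_le_iff intro!: exI[of _ 1] intro: order_trans[of _ 0])
  then have F: "apply_bcontfun F = (\<lambda>x. \<phi> (\<tau> x))" unfolding F_def by (rule apply_Bcontfun)
  have F01: "0 \<le> apply_bcontfun F x \<and> apply_bcontfun F x \<le> 1" for x
    using \<phi>(2) by (simp add: F)
  have cont: "continuous_on UNIV (\<lambda>z. \<phi> (f z))" if "continuous_on UNIV f" for f :: "'k \<Rightarrow> 'k"
    using continuous_on_compose2[OF \<phi>(1) that] by simp
  have op: "open {z. 1/2 < \<phi> (z + \<tau> v)}" "open {v. 1/2 < \<phi> (z + v)}" for v z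
    by (intro open_Collect_less continuous_intros cont)+
  \<comment> \<open>The mean of \<open>F\<close> is positive because, by compactness, finitely many
    translates of the set where \<open>\<phi>\<close> exceeds 1/2 cover the group.\<close>
  have "UNIV \<subseteq> (\<Union>v\<in>UNIV. {z. 1/2 < \<phi> (z + \<tau> v)})"
  proof
    fix z :: 'k
    have "- z \<in> {v. 1/2 < \<phi> (z + v)}" using \<phi>(3) by simp
    then show "z \<in> (\<Union>v\<in>UNIV. {z. 1/2 < \<phi> (z + \<tau> v)})"
      using meets_open[OF op(2)[of z]] by blast
  qed
  then obtain C where C: "finite C" "UNIV \<subseteq> (\<Union>v\<in>C. {z. 1/2 < \<phi> (z + \<tau> v)})"
    using compactE_image[OF compact, of UNIV "\<lambda>v. {z. 1/2 < \<phi> (z + \<tau> v)}"] op(1) by metis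
  have bF: "bounded (range (\<lambda>x. apply_bcontfun F (x + v)))" for v
    using bounded_apply_bcontfun[of "translate v F"] by simp
  have "1/2 = L (\<lambda>_. 1/2)" by (rule mean_const[symmetric])
  also have "\<dots> \<le> L (\<lambda>x. \<Sum>v\<in>C. apply_bcontfun F (x + v))"
  proof (rule mean_mono)
    fix x
    obtain v where v: "v \<in> C" "1/2 < \<phi> (\<tau> x + \<tau> v)" using C(2) by blast
    then have "1/2 \<le> apply_bcontfun F (x + v)" by (simp add: F add)
    also have "\<dots> \<le> (\<Sum>v\<in>C. apply_bcontfun F (x + v))"
      using F01 C(1) v(1) by (intro member_le_sum) auto
    finally show "1/2 \<le> (\<Sum>v\<in>C. apply_bcontfun F (x + v))" .
  qed (auto intro!: bounded_sum_range bF)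
  also have "\<dots> = (\<Sum>v\<in>C. L (\<lambda>x. apply_bcontfun F (x + v)))" by (rule mean_sum[OF bF])
  also have "\<dots> = real (card C) * L (apply_bcontfun F)"
    by (simp add: mean_shift[OF bounded_apply_bcontfun])
  finally have "0 < real (card C) * L (apply_bcontfun F)" by simp
  then have pos: "0 < L (apply_bcontfun F)" by (simp add: zero_less_mult_iff)
  have "hull_dist ((*s) q ` UNIV) F \<le> hull_dist UNIV F" if "q \<noteq> 0" for q
    using uniform_approx[OF \<phi>(1) conn that]
    by (intro hull_dist_le_of_uniform_approx) (simp add: F)
  from recurrence_unscaled[OF F01 pos this w, of a] obtain z y where
    "\<phi> (\<tau> z + \<tau> a) > 0" "\<phi> (\<tau> z + \<tau> (poly_path D w y)) > 0"
    by (auto simp: F add)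
  from \<phi>(4)[OF this(2,1)] show ?thesis by auto
qed

end

text \<open>Density of the level paths is used for \<open>U\<close> itself and for the translate
  \<open>U - \<tau> x\<close>. The latter turns the base point \<open>from_coords B x\<close> into a
  single \<open>b\<close> that serves all determinants at once.\<close>

lemma Bohr_level_sets:
  fixes B :: "'N::finite \<Rightarrow> int^'n^'n" and \<tau> :: "int^'N \<Rightarrow> 'k::{topological_ab_group_add, second_countable_topology, t2_space}"
  assumes d: "CARD('n) \<ge> 2" and B: "Z_basis_of_Sym B"
    and bohr: "Bohr_data \<tau> U (from_coords B -` E)" and conn: "connected (UNIV :: 'k set)"
  obtains x where "from_coords B x \<in> E"
    "\<And>t. \<exists>S. det S = t \<and> S \<in> E" "\<And>t. \<exists>S. det S = t \<and> from_coords B x + S \<in> E"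
proof -
  have hom: "\<And>x y. \<tau> (x + y) = \<tau> x + \<tau> y" "closure (range \<tau>) = UNIV" "compact (UNIV :: 'k set)"
    and U: "open U" "U \<noteq> {}" and EU: "from_coords B -` E = \<tau> -` U"
    using bohr unfolding Bohr_data_def by blast+
  interpret dense_hom \<tau>
    by standard (rule hom)+
  have E: "from_coords B z \<in> E \<longleftrightarrow> \<tau> z \<in> U" for z
    using EU by auto
  obtain D w where w: "\<And>t. zspan D (w t) = UNIV" "\<And>t y. det (from_coords B (poly_path D (w t) y)) = t"
    using det_level_path_coords[OF d B] by blast
  obtain x where x: "\<tau> x \<in> U" using meets_open[OF U] by blast
  have "open ((\<lambda>s. \<tau> x + s) -` U)" using U by (intro open_vimage continuous_intros)
  moreover have "0 \<in> (\<lambda>s. \<tau> x + s) -` U" using x by simp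
  ultimately have "\<exists>y. \<tau> (poly_path D (w t) y) \<in> (\<lambda>s. \<tau> x + s) -` U" for t
    using level_path_dense[OF conn _ _ w(1)] by blast
  then have 1: "\<exists>S. det S = t \<and> from_coords B x + S \<in> E" for t
    using w(2) E by (metis add from_coords_add vimage_eq)
  have "\<exists>y. \<tau> (poly_path D (w t) y) \<in> U" for t
    using level_path_dense[OF conn U w(1)] by blast
  then have 2: "\<exists>S. det S = t \<and> S \<in> E" for t
    using w(2) E by metis
  show thesis using that[of x] x E 1 2 by blast
qed

theorem theorem1p7:
  fixes B :: "'N::finite \<Rightarrow> int^'n^'n"
    and E :: "(int^'n^'n) set"
    and m :: nat
  assumes "CARD('n) \<ge> 2"
    and "CARD('N) = CARD('n) * (CARD('n) + 1) div 2"
    and "Z_basis_of_Sym B"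
    and "E \<subseteq> Sym"
    and "m > 0"
  shows "(upper_Banach_density (from_coords B -` E) > 0 \<longrightarrow> (\<exists>k>0. det_patterns k m E))
    \<and> (aperiodic_Bohr_set
           TYPE('k::{topological_ab_group_add, second_countable_topology, t2_space})
           (from_coords B -` E) \<longrightarrow> det_patterns 1 m E)
    \<and> (aperiodic_Bohr0_set TYPE('k) (from_coords B -` E) \<longrightarrow> det ` E = UNIV)"
proof (intro conjI impI)
  assume "upper_Banach_density (from_coords B -` E) > 0"
  then show "\<exists>k>0. det_patterns k m E"
    by (rule det_patterns_of_positive_density[OF assms(1,3)])
next
  assume "aperiodic_Bohr_set TYPE('k) (from_coords B -` E)"
  then obtain \<tau> :: "int^'N \<Rightarrow> 'k" and U where
    "Bohr_data \<tau> U (from_coords B -` E)" "connected (UNIV :: 'k set)"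
    by (auto simp: aperiodic_Bohr_set_def)
  from Bohr_level_sets[OF assms(1,3) this] obtain x where x: "from_coords B x \<in> E"
    "\<And>t. \<exists>S. det S = t \<and> from_coords B x + S \<in> E" by metis
  have "t \<in> det ` (\<lambda>e. e - from_coords B x) ` E" for t
  proof -
    obtain S where "det S = t" "from_coords B x + S \<in> E" using x(2) by blast
    then show ?thesis by (auto simp: image_iff intro!: bexI[of _ "from_coords B x + S"])
  qed
  then show "det_patterns 1 m E"
    unfolding det_patterns_def using x(1) by auto
next
  assume "aperiodic_Bohr0_set TYPE('k) (from_coords B -` E)"
  then obtain \<tau> :: "int^'N \<Rightarrow> 'k" and U where
    "Bohr_data \<tau> U (from_coords B -` E)" "connected (UNIV :: 'k set)"
    by (auto simp: aperiodic_Bohr0_set_def)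
  from Bohr_level_sets[OF assms(1,3) this] have "\<exists>S. det S = t \<and> S \<in> E" for t by metis
  then have "t \<in> det ` E" for t by (metis image_eqI)
  then show "det ` E = UNIV" by blast
qed

end
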